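(* Let $\lambda:[0,\infty)\to\mathbb R\cup\{\infty\}$ be non-decreasing with $B_\lambda:=\sup\{r\in[0,\infty):\lambda(r)<\infty\}>0$, and let $\mathcal A^\lambda(\mathbb R/2\pi\mathbb Z)$ be the space of analytic functions defined in the context. 1. $\mathcal A^\lambda(\mathbb R/2\pi\mathbb Z)$ equipped with $\|\cdot\|_{\mathcal A^\lambda(\mathbb R/2\pi\mathbb Z)}$ is a Banach space. 2. The Fourier coefficients $\hat g(n)$ of $g\in\mathcal A^\lambda(\mathbb R/2\pi\mathbb Z)$ satisfy $$|\hat g(n)|\le\exp(-\lambda^*(|n|))\,\|g\|_{\mathcal A^\lambda(\mathbb R/2\pi\mathbb Z)},\qquad n\in\mathbb Z.$$ 3. If $P_m$ denotes the $L^2$-orthogonal projection onto $\mathrm{span}\{\exp(\mathrm in\,\cdot):|n|\le m\}$, then there exist $m_0\in\mathbb N$ and a constant $c_\lambda>0$ such that $$\|(I-P_m)g\|_{L^\infty(-\pi,\pi)}\le2c_\lambda\exp(-\lambda^*(m))\,\|g\|_{\mathcal A^\lambda(\mathbb R/2\pi\mathbb Z)}$$ for all $g\in\mathcal A^\lambda(\mathbb R/2\pi\mathbb Z)$ and $m\ge m_0$. 4. (with the constant $c_\lambda$ of part 3) There exists $\delta_0>0$ such that $$\|g\|_{L^\infty(-\pi,\pi)}\le c_\lambda\exp\Big(-\lambda^*\Big(\Big\lfloor\frac\pi\delta-\frac12\Big\rfloor\Big)\Big)\|g\|_{\mathcal A^\lambda(\mathbb R/2\pi\mathbb Z)}+\frac1\delta\|g\|_{L^1(-\pi,\pi)}$$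 for all $g\in\mathcal A^\lambda(\mathbb R/2\pi\mathbb Z)$ and all $0<\delta\le\delta_0$.
   Context: For $B\in(0,\infty]$ let $S_B=\{z\in\mathbb C:|\Im z|<B\}$. For $g\in C(\mathbb R/2\pi\mathbb Z)$, $\tilde g$ denotes the holomorphic extension of $g$ to a strip, if it exists. Define $$\mathcal A^\lambda(\mathbb R/2\pi\mathbb Z):=\{g\in C(\mathbb R/2\pi\mathbb Z):\tilde g\text{ exists on }S_{B_\lambda},\ \|g\|_{\mathcal A^\lambda(\mathbb R/2\pi\mathbb Z)}<\infty\},\quad\|g\|_{\mathcal A^\lambda(\mathbb R/2\pi\mathbb Z)}:=\sup_{z\in S_{B_\lambda}}\big[\exp(-\lambda(|\Im z|))|\tilde g(z)|\big].$$ $\lambda^*(s):=\sup_{r\ge0}[rs-\lambda(r)]$ is the Fenchel conjugate (possibly $+\infty$, with $\exp(-\infty)=0$). $\hat g(n)=\frac1{2\pi}\int_{-\pi}^\pi g(x)e^{-\mathrm inx}\,\mathrm dx$. $\lfloor x\rfloor$ is the largest integer $\le x$. *)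

theory Defs
  imports
    "HOL-Complex_Analysis.Complex_Analysis"
    "HOL-Probability.Essential_Supremum"
    "HOL-Library.Function_Algebras"
begin

section \<open>Extended exponential and Fenchel conjugate\<close>

definition exp_ereal :: "ereal \<Rightarrow> ereal" where
  "exp_ereal x = (case x of ereal r \<Rightarrow> ereal (exp r) | PInfty \<Rightarrow> \<infinity> | MInfty \<Rightarrow> 0)"

lemma exp_ereal_simps [simp]:
  "exp_ereal (ereal r) = ereal (exp r)" "exp_ereal \<infinity> = \<infinity>" "exp_ereal (- \<infinity>) = 0"
  by (simp_all add: exp_ereal_def)

text \<open>A growth function \<open>lam\<close> is a total function on the reals of which only the values
  on \<open>{0..}\<close> matter.\<close>

definition growth_bound :: "(real \<Rightarrow> ereal) \<Rightarrow> ereal" where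
  "growth_bound lam = Sup {ereal r | r. 0 \<le> r \<and> lam r < \<infinity>}"

definition fenchel :: "(real \<Rightarrow> ereal) \<Rightarrow> real \<Rightarrow> ereal" where
  "fenchel lam s = (SUP r\<in>{0..}. ereal (r * s) - lam r)"

section \<open>The space of analytic periodic functions\<close>

definition strip :: "ereal \<Rightarrow> complex set" where
  "strip B = {z. ereal \<bar>Im z\<bar> < B}"

definition periodic_cont :: "(real \<Rightarrow> complex) set" where
  "periodic_cont = {g. continuous_on UNIV g \<and> (\<forall>x. g (x + 2 * pi) = g x)}"

definition is_strip_extension :: "ereal \<Rightarrow> (real \<Rightarrow> complex) \<Rightarrow> (complex \<Rightarrow> complex) \<Rightarrow> bool" where
  "is_strip_extension B g h \<longleftrightarrow> h holomorphic_on strip B \<and> (\<forall>x. h (of_real x) = g x)"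

text \<open>By the identity theorem, the extension is unique on the strip; its values outside the strip
  are arbitrary and never used.\<close>

definition strip_extension :: "ereal \<Rightarrow> (real \<Rightarrow> complex) \<Rightarrow> complex \<Rightarrow> complex" where
  "strip_extension B g = (SOME h. is_strip_extension B g h)"

definition analytic_norm :: "(real \<Rightarrow> ereal) \<Rightarrow> (real \<Rightarrow> complex) \<Rightarrow> ereal" where
  "analytic_norm lam g =
     (SUP z\<in>strip (growth_bound lam).
        exp_ereal (- lam \<bar>Im z\<bar>) * ereal (cmod (strip_extension (growth_bound lam) g z)))"

definition analytic_space :: "(real \<Rightarrow> ereal) \<Rightarrow> (real \<Rightarrow> complex) set" where
  "analytic_space lam =
     {g \<in> periodic_cont. (\<exists>h. is_strip_extension (growth_bound lam) g h) \<and> analytic_norm lam g < \<infinity>}"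

section \<open>Banach spaces on a carrier set\<close>

text \<open>The space depends on the parameter \<open>lam\<close>, so it cannot be an instance of the type class
  \<^class>\<open>banach\<close>.\<close>

definition complex_banach_on ::
    "(complex \<Rightarrow> 'v \<Rightarrow> 'v) \<Rightarrow> 'v::ab_group_add set \<Rightarrow> ('v \<Rightarrow> real) \<Rightarrow> bool" where
  "complex_banach_on smul V N \<longleftrightarrow>
     vector_space smul \<and> module.subspace smul V \<and>
     (\<forall>f\<in>V. 0 \<le> N f \<and> (N f = 0 \<longleftrightarrow> f = 0)) \<and>
     (\<forall>c. \<forall>f\<in>V. N (smul c f) = cmod c * N f) \<and>
     (\<forall>f\<in>V. \<forall>g\<in>V. N (f + g) \<le> N f + N g) \<and>
     Metric_space.mcomplete V (\<lambda>f g. N (f - g))"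

definition fun_scale :: "complex \<Rightarrow> (real \<Rightarrow> complex) \<Rightarrow> real \<Rightarrow> complex" where
  "fun_scale c f = (\<lambda>x. c * f x)"

lemma vector_space_fun_scale: "vector_space fun_scale"
  by standard (auto simp: fun_scale_def fun_eq_iff algebra_simps)

section \<open>Fourier coefficients, the projection and Lebesgue norms\<close>

definition fourier_coeff :: "(real \<Rightarrow> complex) \<Rightarrow> int \<Rightarrow> complex" where
  "fourier_coeff g n =
     of_real (1 / (2 * pi)) * integral {-pi..pi} (\<lambda>x. g x * exp (- \<i> * of_int n * of_real x))"

definition L2_inner :: "(real \<Rightarrow> complex) \<Rightarrow> (real \<Rightarrow> complex) \<Rightarrow> complex" where
  "L2_inner f g = (LINT x|lebesgue_on {-pi<..<pi}. f x * cnj (g x))"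

definition trig_space :: "nat \<Rightarrow> (real \<Rightarrow> complex) set" where
  "trig_space m =
     module.span fun_scale {(\<lambda>x. exp (\<i> * of_int n * of_real x)) | n::int. \<bar>n\<bar> \<le> int m}"

text \<open>Elements of \<^term>\<open>trig_space m\<close> are honest functions, not classes modulo null sets;
  being continuous and periodic, the one singled out here is nevertheless unique.\<close>

definition trig_proj :: "nat \<Rightarrow> (real \<Rightarrow> complex) \<Rightarrow> real \<Rightarrow> complex" where
  "trig_proj m g = (THE p. p \<in> trig_space m \<and> (\<forall>q\<in>trig_space m. L2_inner (g - p) q = 0))"

definition L1_norm :: "(real \<Rightarrow> complex) \<Rightarrow> real" where
  "L1_norm g = (LINT x|lebesgue_on {-pi<..<pi}. cmod (g x))"

definition Linf_norm :: "(real \<Rightarrow> complex) \<Rightarrow> ereal" where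
  "Linf_norm g = esssup (lebesgue_on {-pi<..<pi}) (\<lambda>x. ereal (cmod (g x)))"

end

theory Submission
  imports Defs
begin

text \<open>The extension \<open>h\<close> of \<open>g\<close> is periodic by the identity theorem, so the line of integration in
  the Fourier coefficients may be moved to height \<open>\<plusminus>r\<close>; optimising over \<open>r\<close> gives the factor
  \<open>exp (- \<lambda>*(\<bar>n\<bar>))\<close>. As \<open>\<lambda>*\<close> eventually grows with slope at least some \<open>r0 > 0\<close>, the Fourier tail
  is dominated by a geometric series starting with \<open>exp (- \<lambda>*(m))\<close>. The constant \<open>c\<close> is chosen twice as
  large as part 3 demands, so that part 4 follows by splitting \<open>g\<close> into its \<open>m\<close>-th Fourier sum and the
  tail, with \<open>m = \<lfloor>pi / \<delta> - 1 / 2\<rfloor>\<close>, i.e. \<open>2 * m + 1 \<le> 2 * pi / \<delta>\<close>. Completeness holds because the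
  norm controls uniform convergence on every smaller closed strip.\<close>

section \<open>Periodic holomorphic functions on a strip\<close>

lemma of_real_in_strip: "0 < B \<Longrightarrow> of_real x \<in> strip B"
  by (simp add: strip_def zero_ereal_def)

lemma shift_in_strip [simp]: "z + 2 * of_real pi \<in> strip B \<longleftrightarrow> z \<in> strip B"
  by (simp add: strip_def)

lemma open_strip: "open (strip B)"
proof -
  have "continuous_on UNIV (\<lambda>z. ereal \<bar>Im z\<bar>)"
    by (intro continuous_intros)
  then show ?thesis
    unfolding strip_def by (intro open_Collect_less continuous_intros)
qed

lemma convex_strip: "convex (strip B)"
proof (rule convexI)
  fix x y :: complex and u v :: real
  assume *: "x \<in> strip B" "y \<in> strip B" "0 \<le> u" "0 \<le> v" "u + v = 1"
  have "\<bar>Im (u *\<^sub>R x + v *\<^sub>R y)\<bar> \<le> u * \<bar>Im x\<bar> + v * \<bar>Im y\<bar>"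
    using abs_triangle_ineq[of "u * Im x" "v * Im y"] * by (simp add: abs_mult)
  also have "\<dots> \<le> max \<bar>Im x\<bar> \<bar>Im y\<bar>"
    using * by (intro convex_bound_le) auto
  finally show "u *\<^sub>R x + v *\<^sub>R y \<in> strip B"
    using * by (auto simp: strip_def max_def split: if_splits
        intro: le_less_trans[OF ereal_less_eq(3)[THEN iffD2]])
qed

lemma connected_strip: "connected (strip B)"
  by (simp add: convex_strip convex_connected)

text \<open>The identity theorem on the connected open strip: the real axis accumulates at 0, an
  interior point. This makes the extension of a function unique and carries identities from the real
  axis to the whole strip.\<close>

lemma strip_identity:
  assumes "0 < B" "f holomorphic_on strip B" "g holomorphic_on strip B"
    and "\<And>x. f (of_real x) = g (of_real x)" and "z \<in> strip B"
  shows "f z = g z"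
proof -
  have "(0::complex) islimpt range of_real"
  proof (rule islimptI)
    fix T :: "complex set" assume "0 \<in> T" "open T"
    then obtain e where e: "e > 0" "ball 0 e \<subseteq> T"
      by (meson openE)
    then have "complex_of_real (e / 2) \<in> T"
      by (intro subsetD[OF e(2)]) simp
    moreover have "complex_of_real (e / 2) \<noteq> 0"
      using e(1) by simp
    ultimately show "\<exists>y\<in>range complex_of_real. y \<in> T \<and> y \<noteq> 0"
      by (intro bexI[of _ "complex_of_real (e / 2)"] conjI rangeI)
  qed
  moreover have "(\<lambda>z. f z - g z) holomorphic_on strip B"
    using assms(2,3) by (rule holomorphic_on_diff)
  moreover have "range of_real \<subseteq> strip B" "0 \<in> strip B"
    using of_real_in_strip[OF \<open>0 < B\<close>] of_real_in_strip[OF \<open>0 < B\<close>, of 0] by auto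
  ultimately have "(\<lambda>z. f z - g z) z = 0"
    using assms(4,5) by (elim analytic_continuation[where U = "range of_real"])
      (auto simp: open_strip connected_strip)
  then show ?thesis by simp
qed

text \<open>The translate of \<open>h\<close> by a period is again holomorphic on the strip and
  agrees with \<open>h\<close> on the real axis, so \<open>strip_identity\<close> applies.\<close>

lemma strip_periodic:
  assumes "0 < B" "h holomorphic_on strip B"
    and "\<And>x. h (of_real (x + 2 * pi)) = h (of_real x)" and "z \<in> strip B"
  shows "h (z + 2 * of_real pi) = h z"
proof (rule strip_identity[OF assms(1) _ assms(2) _ assms(4)])
  have "h \<circ> (\<lambda>z. z + 2 * of_real pi) holomorphic_on strip B"
    by (rule holomorphic_on_compose_gen[OF _ assms(2)]) (auto intro!: holomorphic_intros)
  then show "(\<lambda>z. h (z + 2 * of_real pi)) holomorphic_on strip B"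
    by (simp add: o_def)
  show "h (of_real x + 2 * of_real pi) = h (of_real x)" for x
    using assms(3)[of x] by simp
qed

text \<open>With a primitive \<open>P\<close> of \<open>F\<close>, periodicity makes \<open>P (z + 2 * pi) - P z\<close>
  constant, and its value at \<open>z = -pi + i y\<close> is the integral along the line of height \<open>y\<close>.\<close>

lemma integral_line_independent:
  assumes hol: "F holomorphic_on strip B"
    and per: "\<And>z. z \<in> strip B \<Longrightarrow> F (z + 2 * of_real pi) = F z"
    and y: "ereal \<bar>y\<bar> < B"
  shows "integral {-pi..pi} (\<lambda>x. F (of_real x + \<i> * of_real y)) = integral {-pi..pi} (\<lambda>x. F (of_real x))"
proof -
  obtain P where P: "\<And>z. z \<in> strip B \<Longrightarrow> (P has_field_derivative F z) (at z)"
    using holomorphic_convex_primitive'[OF convex_strip open_strip hol]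
    by (metis at_within_open open_strip)
  have line: "integral {-pi..pi} (\<lambda>x. F (of_real x + \<i> * of_real t))
      = P (of_real (-pi) + \<i> * of_real t + 2 * of_real pi) - P (of_real (-pi) + \<i> * of_real t)"
    if t: "ereal \<bar>t\<bar> < B" for t
  proof -
    have "((\<lambda>x. P (of_real x + \<i> * of_real t)) has_vector_derivative F (of_real x + \<i> * of_real t))
        (at x within {-pi..pi})" for x
    proof -
      have "(P has_field_derivative F (of_real x + \<i> * of_real t)) (at (of_real x + \<i> * of_real t))"
        using t by (intro P) (simp add: strip_def)
      then have "((\<lambda>w. P (w + \<i> * of_real t)) has_field_derivative F (of_real x + \<i> * of_real t))
          (at (complex_of_real x))"
        by (simp add: DERIV_shift)
      then show ?thesis
        by (rule has_vector_derivative_real_field)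
    qed
    then have "((\<lambda>x. F (of_real x + \<i> * of_real t)) has_integral
        (P (of_real pi + \<i> * of_real t) - P (of_real (-pi) + \<i> * of_real t))) {-pi..pi}"
      by (intro fundamental_theorem_of_calculus) auto
    moreover have "of_real (-pi) + \<i> * of_real t + 2 * of_real pi = complex_of_real pi + \<i> * of_real t"
      by simp
    ultimately show ?thesis
      by (metis integral_unique)
  qed
  have "(\<lambda>z. P (z + 2 * of_real pi) - P z) constant_on strip B"
  proof (rule has_field_derivative_0_imp_constant_on[OF _ connected_strip open_strip])
    fix z assume z: "z \<in> strip B"
    have "((\<lambda>z. P (z + 2 * of_real pi)) has_field_derivative F (z + 2 * of_real pi)) (at z)"
      using P[of "z + 2 * of_real pi"] z by (simp add: DERIV_shift)
    from DERIV_diff[OF this P[OF z]] show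
      "((\<lambda>z. P (z + 2 * of_real pi) - P z) has_field_derivative 0) (at z)"
      by (simp add: per[OF z])
  qed
  then obtain c where c: "\<And>z. z \<in> strip B \<Longrightarrow> P (z + 2 * of_real pi) - P z = c"
    by (auto simp: constant_on_def)
  have "ereal \<bar>0\<bar> < B"
    using y by (metis abs_ge_zero abs_zero ereal_less_eq(3) le_less_trans)
  then show ?thesis
    using line[OF y] line[of 0] c[of "of_real (-pi) + \<i> * of_real y"] c[of "of_real (-pi)"] y
    by (simp add: strip_def)
qed

text \<open>The coefficient may be computed on the line of height \<open>y\<close>, where
  \<open>exp (- \<i> * n * z)\<close> has modulus \<open>exp (n * y)\<close>. Decay results once
  \<open>y\<close> is given the sign opposite to that of \<open>n\<close>.\<close>

lemma norm_fourier_coeff_strip_le: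
  assumes hol: "h holomorphic_on strip B"
    and per: "\<And>z. z \<in> strip B \<Longrightarrow> h (z + 2 * of_real pi) = h z"
    and y: "ereal \<bar>y\<bar> < B"
    and M: "\<And>x. x \<in> {-pi..pi} \<Longrightarrow> cmod (h (of_real x + \<i> * of_real y)) \<le> M"
  shows "cmod (fourier_coeff (\<lambda>x. h (of_real x)) n) \<le> M * exp (of_int n * y)"
proof -
  define F where "F = (\<lambda>z. h z * exp (- \<i> * of_int n * z))"
  \<comment> \<open>As \<open>n\<close> is an integer, the exponential factor is periodic too, so
    the whole integrand \<open>F\<close> qualifies for the change of line.\<close>
  have ex: "exp (- \<i> * of_int n * (2 * of_real pi)) = 1"
    by (subst exp_eq_1) (auto intro!: exI[of _ "-n"])
  have holF: "F holomorphic_on strip B"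
    unfolding F_def by (intro holomorphic_intros hol)
  have perF: "F (z + 2 * of_real pi) = F z" if "z \<in> strip B" for z
  proof -
    have "F (z + 2 * of_real pi) = h (z + 2 * of_real pi) *
        (exp (- \<i> * of_int n * z) * exp (- \<i> * of_int n * (2 * of_real pi)))"
      unfolding F_def exp_add[symmetric] by (simp add: algebra_simps)
    then show ?thesis
      using per[OF that] ex by (simp add: F_def)
  qed
  have "cmod (integral {-pi..pi} (\<lambda>x. F (of_real x + \<i> * of_real y))) \<le> (M * exp (of_int n * y)) * (pi - - pi)"
  proof (rule integral_bound)
    show "continuous_on {-pi..pi} (\<lambda>x. F (of_real x + \<i> * of_real y))"
      by (rule continuous_on_compose2[OF holomorphic_on_imp_continuous_on[OF holF]])
         (use y in \<open>auto intro!: continuous_intros simp: strip_def\<close>)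
    show "cmod (F (of_real x + \<i> * of_real y)) \<le> M * exp (of_int n * y)" if "x \<in> {-pi..pi}" for x
      using M[OF that] by (auto simp: F_def norm_mult intro!: mult_right_mono)
  qed auto
  moreover have "fourier_coeff (\<lambda>x. h (of_real x)) n
      = of_real (1 / (2 * pi)) * integral {-pi..pi} (\<lambda>x. F (of_real x + \<i> * of_real y))"
    using integral_line_independent[OF holF perF y] by (simp add: fourier_coeff_def F_def)
  ultimately have "cmod (fourier_coeff (\<lambda>x. h (of_real x)) n) * (2 * pi)
      \<le> M * exp (of_int n * y) * (2 * pi)"
    by (simp add: norm_mult norm_divide)
  then show ?thesis
    by (rule mult_right_le_imp_le) simp
qed

text \<open>Chernoff's proof of pointwise convergence: after dividing \<open>h z - h x0\<close> by
  \<open>exp (\<i> (z - x0)) - 1\<close> the partial Fourier sums telescope.\<close>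

lemma strip_divide_by_exp:
  fixes x0 :: complex
  assumes "0 < B" and hol: "h holomorphic_on strip B"
    and per: "\<And>z. z \<in> strip B \<Longrightarrow> h (z + 2 * of_real pi) = h z" and x0: "x0 \<in> strip B"
  obtains q where "q holomorphic_on strip B"
    and "\<And>z. z \<in> strip B \<Longrightarrow> q (z + 2 * of_real pi) = q z"
    and "\<And>z. z \<in> strip B \<Longrightarrow> h z - h x0 = q z * (exp (\<i> * (z - x0)) - 1)"
proof -
  \<comment> \<open>The divisor vanishes at every integer translate of \<open>x0\<close> by
    \<open>2 * pi\<close>, so negative multiples of the period matter as well.\<close>
  have per_int: "h (z + 2 * of_int k * of_real pi) = h z" if "z \<in> strip B" for z and k :: int
  proof -
    have pos: "h (w + 2 * of_nat m * of_real pi) = h w" if w: "w \<in> strip B" for w and m :: nat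
    proof (induction m)
      case (Suc m)
      have "w + 2 * of_nat m * of_real pi \<in> strip B"
        using w by (simp add: strip_def)
      from per[OF this] Suc show ?case
        by (simp add: algebra_simps)
    qed simp
    show ?thesis
    proof (cases k)
      case (nonneg m)
      with pos[OF that, of m] show ?thesis by simp
    next
      case (neg m)
      have "z + 2 * of_int k * of_real pi \<in> strip B"
        using that by (simp add: strip_def)
      moreover have "z + 2 * of_int k * of_real pi + 2 * of_nat (Suc m) * of_real pi = z"
        by (simp add: neg algebra_simps del: of_nat_Suc)
      ultimately show ?thesis
        by (metis pos)
    qed
  qed
  define d where "d = (\<lambda>z. exp (\<i> * (z - x0)) - 1)"
  define f where "f = (\<lambda>z. h z - h x0)"
  \<comment> \<open>At a zero of \<open>d\<close> the derivative of \<open>d\<close> is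
    \<open>\<i>\<close>, so L'Hopital's rule dictates \<open>deriv h z / \<i>\<close> as the value
    that removes the singularity.\<close>
  define q where "q = (\<lambda>z. if d z = 0 then deriv h z / \<i> else f z / d z)"
  have d_zero: "h z = h x0" if dz: "d z = 0" for z
  proof -
    obtain k :: int where "Re (\<i> * (z - x0)) = 0" "Im (\<i> * (z - x0)) = of_int (2 * k) * pi"
      using dz unfolding d_def right_minus_eq exp_eq_1 by blast
    then have "z = x0 + 2 * of_int k * of_real pi"
      by (simp add: complex_eq_iff)
    then show ?thesis
      using per_int[OF x0] by simp
  qed
  have d_per: "d (z + 2 * of_real pi) = d z" for z
  proof -
    have "exp (\<i> * (z + 2 * of_real pi - x0)) = exp (\<i> * (z - x0)) * exp (2 * of_real pi * \<i>)"
      unfolding exp_add[symmetric] by (simp add: algebra_simps)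
    then show ?thesis by (simp add: d_def)
  qed
  have h_deriv: "(h has_field_derivative deriv h z) (at z)" if "z \<in> strip B" for z
    using holomorphic_derivI[OF hol open_strip that] .
  have d_deriv: "(d has_field_derivative \<i> * exp (\<i> * (z - x0))) (at z)" for z
    unfolding d_def by (auto intro!: derivative_eq_intros)
  \<comment> \<open>Periodicity of \<open>q\<close> at the zeros of \<open>d\<close>, where
    \<open>q\<close> is defined through \<open>deriv h\<close>, rests on this.\<close>
  have deriv_per: "deriv h (z + 2 * of_real pi) = deriv h z" if z: "z \<in> strip B" for z
  proof -
    have "((\<lambda>w. h (w + 2 * of_real pi)) has_field_derivative deriv h (z + 2 * of_real pi)) (at z)"
      using h_deriv[of "z + 2 * of_real pi"] z by (simp add: DERIV_shift)
    then have "(h has_field_derivative deriv h (z + 2 * of_real pi)) (at z)"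
      by (rule has_field_derivative_transform_within_open[OF _ open_strip z per])
    then show ?thesis
      using DERIV_unique h_deriv[OF z] by blast
  qed
  have off: "q field_differentiable at z" if z: "z \<in> strip B" and nz: "d z \<noteq> 0" for z
  proof -
    have "open {w. d w \<noteq> 0}"
      by (intro open_Collect_neq) (auto simp: d_def intro!: continuous_intros)
    moreover have "(\<lambda>z. f z / d z) field_differentiable at z"
      unfolding f_def d_def
      using nz h_deriv[OF z] by (auto simp: d_def field_differentiable_def intro!: derivative_eq_intros)
    ultimately show ?thesis
      unfolding field_differentiable_def
      by (elim exE, intro exI) (erule has_field_derivative_transform_within_open, use nz in \<open>auto simp: q_def\<close>)
  qed
  \<comment> \<open>The two ingredients of the removable singularity argument: \<open>q\<close> is
    continuous at a zero of \<open>d\<close>, and that zero is isolated.\<close>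
  have at0: "(q \<longlongrightarrow> q z) (at z) \<and> (\<forall>\<^sub>F w in at z. d w \<noteq> 0)" if z: "z \<in> strip B" and dz: "d z = 0" for z
  proof -
    have e: "exp (\<i> * (z - x0)) = 1"
      using dz by (simp add: d_def)
    have "((\<lambda>w. f w / d w) \<longlongrightarrow> deriv h z / \<i>) (at z)"
    proof (rule lhopital_complex_simple)
      show "(f has_field_derivative deriv h z) (at z)"
        unfolding f_def using h_deriv[OF z] by (auto intro!: derivative_eq_intros)
      show "(d has_field_derivative \<i>) (at z)"
        using d_deriv[of z] e by simp
    qed (use dz d_zero in \<open>auto simp: f_def\<close>)
    moreover have nz: "\<forall>\<^sub>F w in at z. d w \<noteq> 0"
    proof -
      \<comment> \<open>The difference quotient tends to \<open>\<i>\<close>, hence is eventually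
        nonzero; since \<open>d z = 0\<close>, so is \<open>d w\<close>.\<close>
      have "\<forall>\<^sub>F w in at z. (d w - d z) / (w - z) \<noteq> 0"
        using d_deriv[of z] e unfolding has_field_derivative_iff
        by (intro tendsto_imp_eventually_ne[where c = \<i>]) auto
      then show ?thesis
        by eventually_elim (use dz in auto)
    qed
    ultimately show ?thesis
      using dz by (auto simp: q_def elim!: eventually_mono intro: Lim_transform_eventually)
  qed
  have "q holomorphic_on strip B"
    unfolding holomorphic_on_def
  proof
    fix z assume z: "z \<in> strip B"
    show "q field_differentiable at z within strip B"
    proof (cases "d z = 0")
      case True
      obtain e1 where e1: "e1 > 0" "\<And>w. w \<noteq> z \<Longrightarrow> dist w z < e1 \<Longrightarrow> d w \<noteq> 0"
        using at0[OF z True] by (auto simp: eventually_at)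
      obtain e2 where e2: "e2 > 0" "ball z e2 \<subseteq> strip B"
        using open_strip z by (meson openE)
      define U where "U = ball z (min e1 e2)"
      have "q holomorphic_on U"
      proof (rule no_isolated_singularity'[where K = "{z}"])
        show "(q \<longlongrightarrow> q w) (at w within U)" if "w \<in> {z}" for w
          using at0[OF z True] that by (auto intro: tendsto_within_subset)
        have "q field_differentiable at w" if "w \<in> U - {z}" for w
          using that e1(2)[of w] e2(2) by (intro off) (auto simp: U_def dist_commute)
        then show "q holomorphic_on U - {z}"
          by (auto simp: holomorphic_on_def intro: field_differentiable_at_within)
      qed (auto simp: U_def)
      moreover have "z \<in> U" "open U"
        using e1 e2 by (auto simp: U_def)
      ultimately show ?thesis
        using holomorphic_on_imp_differentiable_at field_differentiable_at_within by blast
    next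
      case False
      then show ?thesis
        using off[OF z] field_differentiable_at_within by blast
    qed
  qed
  moreover have "q (z + 2 * of_real pi) = q z" if "z \<in> strip B" for z
    using that by (simp add: q_def d_per deriv_per f_def per)
  moreover have "h z - h x0 = q z * (exp (\<i> * (z - x0)) - 1)" if "z \<in> strip B" for z
    using d_zero[of z] by (auto simp: q_def d_def f_def)
  ultimately show ?thesis
    using that by blast
qed

section \<open>Algebra of Fourier coefficients and pointwise convergence of the symmetric partial
  sums\<close>

definition fourier_sum :: "nat \<Rightarrow> (real \<Rightarrow> complex) \<Rightarrow> real \<Rightarrow> complex" where
  "fourier_sum m g = (\<lambda>x. \<Sum>n = - int m..int m. fourier_coeff g n * exp (\<i> * of_int n * of_real x))"

lemma fourier_coeff_diff:
  assumes "continuous_on {-pi..pi} f" "continuous_on {-pi..pi} g"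
  shows "fourier_coeff (\<lambda>x. f x - g x) n = fourier_coeff f n - fourier_coeff g n"
  using assms unfolding fourier_coeff_def left_diff_distrib
  by (subst integral_diff) (auto simp: algebra_simps intro!: integrable_continuous_real continuous_intros)

lemma fourier_coeff_add:
  assumes "continuous_on {-pi..pi} f" "continuous_on {-pi..pi} g"
  shows "fourier_coeff (\<lambda>x. f x + g x) n = fourier_coeff f n + fourier_coeff g n"
  using assms unfolding fourier_coeff_def distrib_right
  by (subst integral_add) (auto simp: algebra_simps intro!: integrable_continuous_real continuous_intros)

lemma fourier_coeff_scale: "fourier_coeff (\<lambda>x. c * f x) n = c * fourier_coeff f n"
  by (simp add: fourier_coeff_def mult.assoc)

text \<open>In the quotient identity of \<open>strip_divide_by_exp\<close>, this turns the factor
  \<open>exp (\<i> * (z - x0))\<close> into an index shift by one, and so produces differences that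
  telescope.\<close>

lemma fourier_coeff_shift:
  "fourier_coeff (\<lambda>x. exp (\<i> * of_int k * of_real x) * f x) n = fourier_coeff f (n - k)"
  unfolding fourier_coeff_def
  by (rule arg_cong[where f = "\<lambda>I. _ * integral _ I"])
     (auto simp: fun_eq_iff algebra_simps simp flip: exp_add)

lemma fourier_coeff_one: "fourier_coeff (\<lambda>x. 1) n = (if n = 0 then 1 else 0)"
proof (cases "n = 0")
  case False
  have "((\<lambda>x. exp (- \<i> * of_int n * complex_of_real x)) has_integral
      exp (- \<i> * of_int n * complex_of_real pi) / (- \<i> * of_int n)
      - exp (- \<i> * of_int n * complex_of_real (-pi)) / (- \<i> * of_int n)) {-pi..pi}"
  proof (rule fundamental_theorem_of_calculus)
    fix x :: real
    have "((\<lambda>w. exp (- \<i> * of_int n * w) / (- \<i> * of_int n)) has_field_derivative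
        exp (- \<i> * of_int n * of_real x)) (at (of_real x))"
      using False by (auto intro!: derivative_eq_intros)
    then show "((\<lambda>x. exp (- \<i> * of_int n * complex_of_real x) / (- \<i> * of_int n)) has_vector_derivative
        exp (- \<i> * of_int n * complex_of_real x)) (at x within {-pi..pi})"
      by (rule has_vector_derivative_real_field)
  qed simp
  \<comment> \<open>The two exponents differ by an integer multiple of \<open>2 * pi * \<i>\<close>,
    so the boundary terms of the antiderivative cancel.\<close>
  moreover have "exp (- \<i> * of_int n * complex_of_real pi) = exp (- \<i> * of_int n * complex_of_real (-pi))"
    by (subst exp_eq) (auto intro!: exI[of _ "-n"])
  ultimately show ?thesis
    using False by (simp add: fourier_coeff_def integral_unique)
qed (simp add: fourier_coeff_def scaleR_conv_of_real)

lemma fourier_coeff_exp: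
  "fourier_coeff (\<lambda>x. exp (\<i> * of_int k * of_real x)) n = (if n = k then 1 else 0)"
  using fourier_coeff_shift[of k "\<lambda>_. 1" n] fourier_coeff_one[of "n - k"] by simp

lemma sum_telescope_symmetric:
  fixes a :: "int \<Rightarrow> 'a::ab_group_add"
  shows "(\<Sum>n=-int m..int m. a (n - 1) - a n) = a (- int m - 1) - a (int m)"
proof (induction m)
  case (Suc m)
  have "{- int (Suc m)..int (Suc m)} = insert (- int m - 1) (insert (int m + 1) {-int m..int m})"
    by auto
  then have "(\<Sum>n=-int (Suc m)..int (Suc m). a (n - 1) - a n)
      = a (- int m - 1 - 1) - a (- int m - 1) + (a (int m + 1 - 1) - a (int m + 1)
        + (\<Sum>n=-int m..int m. a (n - 1) - a n))"
    by (simp only:) (subst sum.insert, simp, simp, subst sum.insert, simp_all)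
  moreover have "- int (Suc m) - 1 = - int m - 1 - 1" "int (Suc m) = int m + 1"
    by simp_all
  ultimately show ?case
    unfolding Suc.IH by (simp only: add_diff_cancel_right' diff_add_cancel) simp
qed simp

text \<open>Telescoping leaves, besides the limit, only two boundary coefficients of the quotient
  \<open>q\<close>, times numbers of modulus one. Moving the line of integration to height
  \<open>r\<close> or \<open>-r\<close> shows that both decay exponentially.\<close>

theorem fourier_sum_tendsto:
  assumes B: "0 < B" and hol: "h holomorphic_on strip B"
    and per: "\<And>z. z \<in> strip B \<Longrightarrow> h (z + 2 * of_real pi) = h z"
  shows "(\<lambda>m. fourier_sum m (\<lambda>x. h (of_real x)) x0) \<longlonglongrightarrow> h (of_real x0)"
proof -
  obtain q where q: "q holomorphic_on strip B"
    "\<And>z. z \<in> strip B \<Longrightarrow> q (z + 2 * of_real pi) = q z"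
    "\<And>z. z \<in> strip B \<Longrightarrow> h z - h (of_real x0) = q z * (exp (\<i> * (z - of_real x0)) - 1)"
    using strip_divide_by_exp[OF B hol per of_real_in_strip[OF B]] by metis
  define g where "g = (\<lambda>x. h (complex_of_real x))"
  define p where "p = (\<lambda>x. q (complex_of_real x))"
  define e where "e = (\<lambda>n::int. exp (\<i> * of_int n * of_real x0))"
  have contp: "continuous_on S p" for S
    unfolding p_def by (rule continuous_on_compose2[OF holomorphic_on_imp_continuous_on[OF q(1)]])
      (auto intro!: continuous_intros of_real_in_strip[OF B])
  \<comment> \<open>The explicit factors \<open>1\<close> and \<open>of_int 1\<close> put the
    identity into the shape to which \<open>fourier_coeff_scale\<close> and
    \<open>fourier_coeff_shift\<close> apply.\<close>
  have g_eq: "g = (\<lambda>x. g x0 * 1 + (e (-1) * (exp (\<i> * of_int 1 * of_real x) * p x) - p x))"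
  proof
    fix x
    have "exp (\<i> * (of_real x - of_real x0)) = e (-1) * exp (\<i> * of_int 1 * of_real x)"
      by (simp add: e_def algebra_simps flip: exp_add)
    then show "g x = g x0 * 1 + (e (-1) * (exp (\<i> * of_int 1 * of_real x) * p x) - p x)"
      using q(3)[OF of_real_in_strip[OF B, of x]] by (simp add: g_def p_def algebra_simps)
  qed
  have coeff: "fourier_coeff g n * e n = (if n = 0 then g x0 else 0) +
      (fourier_coeff p (n - 1) * e (n - 1) - fourier_coeff p n * e n)" for n
  proof -
    have eq: "fourier_coeff g n = g x0 * fourier_coeff (\<lambda>x. 1) n +
        (e (-1) * fourier_coeff p (n - 1) - fourier_coeff p n)"
      by (subst g_eq, subst fourier_coeff_add, (intro continuous_intros contp)+,
          subst fourier_coeff_diff, (intro continuous_intros contp)+)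
         (simp only: fourier_coeff_scale fourier_coeff_shift)
    have "fourier_coeff g n * e n = g x0 * fourier_coeff (\<lambda>x. 1) n * e n +
        (fourier_coeff p (n - 1) * (e (-1) * e n) - fourier_coeff p n * e n)"
      unfolding eq by (simp only: algebra_simps)
    moreover have "e (-1) * e n = e (n - 1)"
      by (simp add: e_def algebra_simps flip: exp_add)
    moreover have "e 0 = 1" by (simp add: e_def)
    ultimately show ?thesis
      by (auto simp: fourier_coeff_one)
  qed
  have sum_eq: "fourier_sum m g x0 = g x0 +
      (fourier_coeff p (- int m - 1) * e (- int m - 1) - fourier_coeff p (int m) * e (int m))" for m
  proof -
    have "fourier_sum m g x0 = (\<Sum>n=-int m..int m. fourier_coeff g n * e n)"
      by (simp add: fourier_sum_def e_def)
    also have "\<dots> = (\<Sum>n=-int m..int m. if n = 0 then g x0 else 0) +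
        (\<Sum>n=-int m..int m. fourier_coeff p (n - 1) * e (n - 1) - fourier_coeff p n * e n)"
      by (simp only: coeff sum.distrib)
    also have "(\<Sum>n=-int m..int m. if n = 0 then g x0 else 0) = g x0"
      by simp
    also have "(\<Sum>n=-int m..int m. fourier_coeff p (n - 1) * e (n - 1) - fourier_coeff p n * e n)
        = fourier_coeff p (- int m - 1) * e (- int m - 1) - fourier_coeff p (int m) * e (int m)"
      by (rule sum_telescope_symmetric)
    finally show ?thesis .
  qed
  obtain r where r: "0 < r" "ereal r < B"
    using B ereal_dense2[of 0 B] by (auto simp: zero_ereal_def)
  \<comment> \<open>Nothing is known about the growth of \<open>q\<close> in the strip, but on each
    of the two compact segments continuity alone gives a bound.\<close>
  have "\<exists>M. \<forall>x\<in>{-pi..pi}. cmod (q (of_real x + \<i> * of_real y)) \<le> M" if "\<bar>y\<bar> = r" for y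
  proof -
    have "continuous_on {-pi..pi} (\<lambda>x. q (of_real x + \<i> * of_real y))"
      by (rule continuous_on_compose2[OF holomorphic_on_imp_continuous_on[OF q(1)]])
         (use r that in \<open>auto intro!: continuous_intros simp: strip_def\<close>)
    then have "compact ((\<lambda>x. q (of_real x + \<i> * of_real y)) ` {-pi..pi})"
      by (intro compact_continuous_image) auto
    then show ?thesis
      by (auto dest!: compact_imp_bounded simp: bounded_iff)
  qed
  then obtain M1 M2 where M:
      "\<And>x. x \<in> {-pi..pi} \<Longrightarrow> cmod (q (of_real x + \<i> * of_real r)) \<le> M1"
      "\<And>x. x \<in> {-pi..pi} \<Longrightarrow> cmod (q (of_real x + \<i> * of_real (-r))) \<le> M2"
    using r(1) by (metis abs_minus_cancel abs_of_pos)
  have lim: "(\<lambda>m. M * exp (- of_nat m * r)) \<longlonglongrightarrow> 0" for M :: real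
  proof -
    have "(\<lambda>m. M * exp (- r) ^ m) \<longlonglongrightarrow> M * 0"
      using r by (intro tendsto_intros LIMSEQ_realpow_zero) auto
    then show ?thesis
      by (simp add: exp_of_nat_mult[symmetric])
  qed
  have ne: "cmod (e n) = 1" for n
    by (simp add: e_def)
  \<comment> \<open>A negative index calls for the height \<open>r\<close>. The index
    \<open>- m - 1\<close> accounts for the additional factor \<open>exp (- r)\<close>.\<close>
  have "(\<lambda>m. fourier_coeff p (- int m - 1) * e (- int m - 1)) \<longlonglongrightarrow> 0"
  proof (rule Lim_null_comparison[OF always_eventually lim[of "M1 * exp (-r)"]], rule allI)
    fix m
    have "exp (of_int (- int m - 1) * r) = exp (-r) * exp (- of_nat m * r)"
      unfolding exp_add[symmetric] by (rule arg_cong[where f = exp]) (simp add: algebra_simps)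
    then show "cmod (fourier_coeff p (- int m - 1) * e (- int m - 1)) \<le> M1 * exp (-r) * exp (- of_nat m * r)"
      using norm_fourier_coeff_strip_le[OF q(1,2), of r M1 "- int m - 1"] r M(1)
      by (simp add: norm_mult ne p_def mult.assoc)
  qed
  moreover have "(\<lambda>m. fourier_coeff p (int m) * e (int m)) \<longlonglongrightarrow> 0"
  proof (rule Lim_null_comparison[OF always_eventually lim[of "M2"]], rule allI)
    fix m
    show "cmod (fourier_coeff p (int m) * e (int m)) \<le> M2 * exp (- of_nat m * r)"
      using norm_fourier_coeff_strip_le[OF q(1,2), of "-r" M2 "int m"] r M(2)
      by (simp add: norm_mult ne p_def)
  qed
  ultimately have "(\<lambda>m. fourier_sum m g x0) \<longlonglongrightarrow> g x0 + (0 - 0)"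
    unfolding sum_eq by (intro tendsto_intros)
  then show ?thesis
    by (simp add: g_def)
qed

section \<open>The orthogonal projection onto trigonometric polynomials\<close>

text \<open>Connects the Lebesgue integrals over the open interval in \<open>L1_norm\<close> and
  \<open>L2_inner\<close> with the gauge integral over the closed interval in
  \<open>fourier_coeff\<close>. Integrability is inherited from the compact interval, and the end
  points do not affect the integral.\<close>

lemma lebesgue_integral_open_eq_integral:
  fixes f :: "real \<Rightarrow> 'b::euclidean_space"
  assumes "continuous_on UNIV f"
  shows "integral\<^sup>L (lebesgue_on {a<..<b}) f = integral {a..b} f"
proof -
  have "integrable (lebesgue_on {a..b}) f"
    by (intro continuous_imp_integrable_real continuous_on_subset[OF assms]) auto
  then have "set_integrable lebesgue {a..b} f"
    by (simp add: set_integrable_def integrable_restrict_space)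
  then have "set_integrable lebesgue {a<..<b} f"
    by (rule set_integrable_subset) auto
  then have "integrable (lebesgue_on {a<..<b}) f"
    by (simp add: set_integrable_def integrable_restrict_space)
  then show ?thesis
    by (simp add: lebesgue_integral_eq_integral integral_open_interval_real)
qed

lemma Linf_norm_le:
  assumes "continuous_on UNIV f" "\<And>x. ereal (cmod (f x)) \<le> K"
  shows "Linf_norm f \<le> K"
  unfolding Linf_norm_def
proof (rule esssup_I)
  have "(\<lambda>x. cmod (f x)) \<in> borel_measurable (lebesgue_on {-pi<..<pi})"
    by (intro continuous_imp_measurable_on_sets_lebesgue continuous_intros
        continuous_on_subset[OF assms(1)]) auto
  then show "(\<lambda>x. ereal (cmod (f x))) \<in> borel_measurable (lebesgue_on {-pi<..<pi})"
    by (rule borel_measurable_ereal)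
qed (simp add: assms(2))

lemma norm_fourier_coeff_le_L1:
  assumes "continuous_on UNIV g"
  shows "cmod (fourier_coeff g n) \<le> L1_norm g / (2 * pi)"
proof -
  have c: "continuous_on S g" for S
    using assms continuous_on_subset by blast
  have "cmod (integral {-pi..pi} (\<lambda>x. g x * exp (- \<i> * of_int n * of_real x)))
      \<le> integral {-pi..pi} (\<lambda>x. cmod (g x))"
    by (rule integral_norm_bound_integral)
       (auto intro!: integrable_continuous_real continuous_intros c simp: norm_mult)
  moreover have "L1_norm g = integral {-pi..pi} (\<lambda>x. cmod (g x))"
    unfolding L1_norm_def
    by (rule lebesgue_integral_open_eq_integral) (intro continuous_intros c)
  ultimately show ?thesis
    by (simp add: fourier_coeff_def norm_mult norm_divide divide_right_mono)
qed

interpretation fun_space: vector_space fun_scale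
  by (rule vector_space_fun_scale)

lemma continuous_on_fourier_sum: "continuous_on S (fourier_sum m g)"
  unfolding fourier_sum_def by (intro continuous_intros)

lemma fourier_sum_in_trig_space: "fourier_sum m g \<in> trig_space m"
proof -
  have "fourier_sum m g = (\<Sum>n=-int m..int m. fun_scale (fourier_coeff g n) (\<lambda>x. exp (\<i> * of_int n * of_real x)))"
  proof
    fix x
    have "sum F A x = (\<Sum>n\<in>A. F n x)" for F :: "int \<Rightarrow> real \<Rightarrow> complex" and A
      by (induction A rule: infinite_finite_induct) auto
    then show "fourier_sum m g x =
        (\<Sum>n=-int m..int m. fun_scale (fourier_coeff g n) (\<lambda>x. exp (\<i> * of_int n * of_real x))) x"
      by (simp add: fourier_sum_def fun_scale_def)
  qed
  also have "\<dots> \<in> trig_space m"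
    unfolding trig_space_def
    by (intro fun_space.span_sum fun_space.span_scale fun_space.span_base) auto
  finally show ?thesis .
qed

text \<open>Addition and scaling are merged into one case, so that linearity is checked once per
  application; \<open>c = 1\<close> and \<open>g = 0\<close> recover the two separate rules.\<close>

lemma trig_space_induct [consumes 1, case_names zero add_scale exp]:
  assumes "p \<in> trig_space m" "P 0"
    and "\<And>c f g. P f \<Longrightarrow> P g \<Longrightarrow> P (fun_scale c f + g)"
    and "\<And>n. \<bar>n\<bar> \<le> int m \<Longrightarrow> P (\<lambda>x. exp (\<i> * of_int n * of_real x))"
  shows "P p"
  using assms(1) unfolding trig_space_def
proof (rule fun_space.span_induct)
  have "P (f + g)" if "P f" "P g" for f g
    using assms(3)[OF that, of 1] by simp
  moreover have "P (fun_scale c f)" if "P f" for c f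
    using assms(3)[OF that assms(2), of c] by simp
  ultimately show "fun_space.subspace (Collect P)"
    using assms(2) by (auto simp: fun_space.subspace_def)
qed (use assms(4) in auto)

text \<open>Continuity is carried through the induction because additivity of the coefficients
  relies on it. The reproducing property is what later gives uniqueness of the projection.\<close>

lemma trig_space_fourier_sum:
  assumes "p \<in> trig_space m"
  shows "continuous_on UNIV p \<and> fourier_sum m p = p"
  using assms
proof (induction rule: trig_space_induct)
  case zero
  show ?case
    by (auto simp: fourier_sum_def fourier_coeff_def zero_fun_def)
next
  case (add_scale c f g)
  then have cont: "continuous_on S f" "continuous_on S g" for S
    by (auto intro: continuous_on_subset)
  have eq: "fun_scale c f + g = (\<lambda>x. c * f x + g x)"
    by (auto simp: fun_scale_def)
  have "fourier_coeff (fun_scale c f + g) n = c * fourier_coeff f n + fourier_coeff g n" for n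
    unfolding eq
    by (subst fourier_coeff_add) (auto intro!: continuous_intros cont simp: fourier_coeff_scale)
  then have "fourier_sum m (fun_scale c f + g) x = c * fourier_sum m f x + fourier_sum m g x" for x
    by (simp add: fourier_sum_def algebra_simps sum.distrib sum_distrib_left)
  then show ?case
    using add_scale by (auto simp: eq intro!: continuous_intros cont)
next
  case (exp n)
  have "fourier_sum m (\<lambda>x. exp (\<i> * of_int n * of_real x)) x = exp (\<i> * of_int n * of_real x)" for x
  proof -
    have "fourier_sum m (\<lambda>x. exp (\<i> * of_int n * of_real x)) x =
        (\<Sum>k=-int m..int m. if k = n then exp (\<i> * of_int n * of_real x) else 0)"
      unfolding fourier_sum_def fourier_coeff_exp by (rule sum.cong) auto
    also have "\<dots> = exp (\<i> * of_int n * of_real x)"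
      using exp by (auto simp: abs_le_iff)
    finally show ?thesis .
  qed
  then show ?case
    by (auto intro!: continuous_intros)
qed

lemma L2_inner_exp:
  assumes "continuous_on UNIV f"
  shows "L2_inner f (\<lambda>x. exp (\<i> * of_int n * of_real x)) = 2 * pi * fourier_coeff f n"
proof -
  have "cnj (exp (\<i> * of_int n * of_real x)) = exp (- \<i> * of_int n * of_real x)" for x
    by (simp add: exp_cnj)
  then have "L2_inner f (\<lambda>x. exp (\<i> * of_int n * of_real x)) =
      integral {-pi..pi} (\<lambda>x. f x * exp (- \<i> * of_int n * of_real x))"
    unfolding L2_inner_def
    by (subst lebesgue_integral_open_eq_integral) (auto intro!: continuous_intros assms)
  then show ?thesis
    by (simp add: fourier_coeff_def)
qed

lemma L2_inner_lin_right:
  assumes "continuous_on UNIV f" "continuous_on UNIV p" "continuous_on UNIV q"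
  shows "L2_inner f (fun_scale c p + q) = cnj c * L2_inner f p + L2_inner f q"
proof -
  have c: "continuous_on S f" "continuous_on S p" "continuous_on S q" for S
    using assms continuous_on_subset by blast+
  have "L2_inner f (fun_scale c p + q) =
      integral {-pi..pi} (\<lambda>x. cnj c * (f x * cnj (p x)) + f x * cnj (q x))"
    unfolding L2_inner_def
    by (subst lebesgue_integral_open_eq_integral)
       (auto intro!: continuous_intros c simp: fun_scale_def algebra_simps)
  also have "\<dots> = integral {-pi..pi} (\<lambda>x. cnj c * (f x * cnj (p x))) + integral {-pi..pi} (\<lambda>x. f x * cnj (q x))"
    by (intro integral_add integrable_continuous_real continuous_intros c)
  also have "\<dots> = cnj c * L2_inner f p + L2_inner f q"
    unfolding L2_inner_def
    by (subst (1 2) lebesgue_integral_open_eq_integral) (auto intro!: continuous_intros c)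
  finally show ?thesis .
qed

text \<open>Uniqueness of the projection needs no definiteness of the inner product: orthogonality to
  the exponentials determines the Fourier coefficients, hence the trigonometric polynomial.\<close>

lemma trig_proj_eq_fourier_sum:
  assumes g: "continuous_on UNIV g"
  shows "trig_proj m g = fourier_sum m g"
  unfolding trig_proj_def
proof (rule the_equality, intro conjI ballI)
  define f where "f = g - fourier_sum m g"
  have contf: "continuous_on UNIV f"
    unfolding f_def fun_diff_def by (intro continuous_intros g continuous_on_fourier_sum)
  have idem: "fourier_coeff (fourier_sum m g) n = fourier_coeff g n" if "\<bar>n\<bar> \<le> int m" for n
  proof -
    \<comment> \<open>Generalised to an arbitrary finite index set and arbitrary coefficients to
      make the induction possible.\<close>
    have *: "fourier_coeff (\<lambda>x. \<Sum>k\<in>A. a k * exp (\<i> * of_int k * of_real x)) n =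
        (if n \<in> A then a n else 0)" if "finite A" for A and a :: "int \<Rightarrow> complex"
      using that
    proof (induction A)
      case empty
      show ?case by (simp add: fourier_coeff_def)
    next
      case (insert k A)
      then have "fourier_coeff (\<lambda>x. \<Sum>k\<in>insert k A. a k * exp (\<i> * of_int k * of_real x)) n
          = fourier_coeff (\<lambda>x. a k * exp (\<i> * of_int k * of_real x)
              + (\<Sum>k\<in>A. a k * exp (\<i> * of_int k * of_real x))) n"
        by simp
      also have "\<dots> = a k * (if n = k then 1 else 0) + (if n \<in> A then a n else 0)"
        by (subst fourier_coeff_add)
           (auto intro!: continuous_intros simp only: fourier_coeff_scale fourier_coeff_exp insert.IH)
      finally show ?case
        using insert.hyps by auto
    qed
    show ?thesis
      unfolding fourier_sum_def using *[of "{-int m..int m}" "fourier_coeff g"] that by auto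
  qed
  show "fourier_sum m g \<in> trig_space m"
    by (rule fourier_sum_in_trig_space)
  fix q assume q: "q \<in> trig_space m"
  \<comment> \<open>Continuity is part of the induction claim since
    \<open>L2_inner_lin_right\<close> asks for it.\<close>
  then have "continuous_on UNIV q \<and> L2_inner f q = 0"
  proof (induction rule: trig_space_induct)
    case zero
    show ?case by (simp add: L2_inner_def zero_fun_def)
  next
    case (add_scale c p h)
    then have "L2_inner f (fun_scale c p + h) = 0"
      using L2_inner_lin_right[OF contf, of p h c] by simp
    moreover have "continuous_on UNIV (fun_scale c p + h)"
      unfolding fun_scale_def plus_fun_def using add_scale by (intro continuous_intros) auto
    ultimately show ?case by (intro conjI)
  next
    case (exp n)
    have "fourier_coeff f n = fourier_coeff g n - fourier_coeff (fourier_sum m g) n"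
      unfolding f_def fun_diff_def
      by (intro fourier_coeff_diff continuous_on_fourier_sum continuous_on_subset[OF g]) auto
    with L2_inner_exp[OF contf, of n] idem[OF exp] show ?case
      by (auto intro!: continuous_intros)
  qed
  then show "L2_inner (g - fourier_sum m g) q = 0"
    by (simp only: f_def)
next
  fix p assume p: "p \<in> trig_space m \<and> (\<forall>q\<in>trig_space m. L2_inner (g - p) q = 0)"
  have contp: "continuous_on UNIV p" and p_eq: "fourier_sum m p = p"
    using trig_space_fourier_sum p by auto
  have contgp: "continuous_on UNIV (g - p)"
    unfolding fun_diff_def by (intro continuous_intros g contp)
  have "fourier_coeff p n = fourier_coeff g n" if "\<bar>n\<bar> \<le> int m" for n
  proof -
    have "(\<lambda>x. exp (\<i> * of_int n * of_real x)) \<in> trig_space m"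
      unfolding trig_space_def using that by (intro fun_space.span_base) auto
    with p have "fourier_coeff (g - p) n = 0"
      using L2_inner_exp[OF contgp, of n] by auto
    moreover have "fourier_coeff (g - p) n = fourier_coeff g n - fourier_coeff p n"
      unfolding fun_diff_def
      by (intro fourier_coeff_diff continuous_on_subset[OF g] continuous_on_subset[OF contp]) auto
    ultimately show ?thesis by simp
  qed
  then have "fourier_sum m p = fourier_sum m g"
    unfolding fourier_sum_def by (intro ext sum.cong) auto
  with p_eq show "p = fourier_sum m g" by simp
qed

text \<open>There are \<open>2 * m + 1\<close> frequencies, each with a coefficient controlled by
  the mean of \<open>cmod \<circ> g\<close>. This is the source of the \<open>L1_norm\<close> term
  in the last estimate of the theorem.\<close>

lemma norm_fourier_sum_le:
  assumes "continuous_on UNIV g"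
  shows "cmod (fourier_sum m g x) \<le> (2 * real m + 1) / (2 * pi) * L1_norm g"
proof -
  have "cmod (fourier_sum m g x) \<le> (\<Sum>n=-int m..int m. cmod (fourier_coeff g n))"
    unfolding fourier_sum_def by (rule sum_norm_le) (simp add: norm_mult)
  also have "\<dots> \<le> of_nat (card {-int m..int m}) * (L1_norm g / (2 * pi))"
    by (intro sum_bounded_above norm_fourier_coeff_le_L1 assms)
  also have "\<dots> = (2 * real m + 1) / (2 * pi) * L1_norm g"
    by (simp add: algebra_simps)
  finally show ?thesis .
qed

lemma fourier_sum_Suc:
  "fourier_sum (Suc m) g x = fourier_sum m g x
    + fourier_coeff g (int (Suc m)) * exp (\<i> * of_int (int (Suc m)) * of_real x)
    + fourier_coeff g (- int (Suc m)) * exp (\<i> * of_int (- int (Suc m)) * of_real x)"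
proof -
  have "{- int (Suc m)..int (Suc m)} = insert (- int (Suc m)) (insert (int (Suc m)) {-int m..int m})"
    by auto
  then show ?thesis
    unfolding fourier_sum_def
    by (simp only:) (subst sum.insert, simp, simp, subst sum.insert, simp_all only: add_ac, simp_all)
qed

section \<open>The Banach space of a growth function\<close>

locale growth_function =
  fixes lam :: "real \<Rightarrow> ereal"
  assumes not_MInf: "0 \<le> r \<Longrightarrow> lam r \<noteq> -\<infinity>"
    and mono_lam: "mono_on {0..} lam"
    and growth_bound_pos: "growth_bound lam > 0"
begin

abbreviation B :: ereal where "B \<equiv> growth_bound lam"

text \<open>Turns the weight into a real number for arithmetic; it is faithful on
  \<open>[0, B)\<close> by \<open>lam_eq_L\<close>, whereas an infinite value becomes the default
  0.\<close>

definition L :: "real \<Rightarrow> real" where "L r = real_of_ereal (lam r)"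

definition N :: "(real \<Rightarrow> complex) \<Rightarrow> real" where "N g = real_of_ereal (analytic_norm lam g)"

text \<open>By definition of the supremum \<open>B\<close>, some \<open>s > r\<close> has finite
  \<open>lam s\<close>, and monotonicity passes finiteness down to \<open>r\<close>.\<close>

lemma lam_eq_L:
  assumes "0 \<le> r" "ereal r < B"
  shows "lam r = ereal (L r)"
proof -
  obtain s where s: "r < s" "lam s < \<infinity>"
    using assms(2) unfolding growth_bound_def less_Sup_iff by auto
  then have "lam r \<le> lam s"
    using assms(1) by (intro mono_onD[OF mono_lam]) auto
  with s(2) have "lam r \<noteq> \<infinity>"
    by auto
  with not_MInf[OF assms(1)] show ?thesis
    by (cases "lam r") (auto simp: L_def)
qed

lemma L_mono: "0 \<le> r \<Longrightarrow> r \<le> s \<Longrightarrow> ereal s < B \<Longrightarrow> L r \<le> L s"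
  using mono_onD[OF mono_lam, of r s] lam_eq_L[of r] lam_eq_L[of s] le_less_trans[of "ereal r" "ereal s" B]
  by simp

lemma exp_ereal_weight:
  "z \<in> strip B \<Longrightarrow> exp_ereal (- lam \<bar>Im z\<bar>) = ereal (exp (- L \<bar>Im z\<bar>))"
  by (simp add: strip_def lam_eq_L)

lemma strip_extension_eq:
  assumes "is_strip_extension B g h" "z \<in> strip B"
  shows "strip_extension B g z = h z"
proof -
  have "is_strip_extension B g (strip_extension B g)"
    unfolding strip_extension_def using someI[of "is_strip_extension B g", OF assms(1)] by simp
  then show ?thesis
    using assms strip_identity[OF growth_bound_pos, of "strip_extension B g" h z]
    by (auto simp: is_strip_extension_def)
qed

lemma analytic_norm_eq:
  assumes "is_strip_extension B g h"
  shows "analytic_norm lam g = (SUP z\<in>strip B. ereal (exp (- L \<bar>Im z\<bar>) * cmod (h z)))"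
  unfolding analytic_norm_def
  by (intro SUP_cong) (auto simp: exp_ereal_weight strip_extension_eq[OF assms])

text \<open>Clearing the positive weight turns the extended-real supremum of a chosen extension into
  real pointwise bounds for whichever extension is at hand. The norm estimates below go through this
  form.\<close>

lemma analytic_norm_le_iff:
  assumes "is_strip_extension B g h"
  shows "analytic_norm lam g \<le> ereal K \<longleftrightarrow> (\<forall>z\<in>strip B. cmod (h z) \<le> K * exp (L \<bar>Im z\<bar>))"
  unfolding analytic_norm_eq[OF assms] SUP_le_iff
  by (intro ball_cong) (auto simp: exp_minus field_simps)

lemma analytic_norm_nonneg: "0 \<le> analytic_norm lam g"
  unfolding analytic_norm_def
proof (rule SUP_upper2)
  show "0 \<in> strip B"
    using of_real_in_strip[OF growth_bound_pos, of 0] by simp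
  then show "0 \<le> exp_ereal (- lam \<bar>Im 0\<bar>) * ereal (cmod (strip_extension B g 0))"
    by (subst exp_ereal_weight) auto
qed

lemma N_nonneg: "0 \<le> N g"
  unfolding N_def using analytic_norm_nonneg by (rule real_of_ereal_pos)

lemma analytic_norm_eq_N:
  assumes "g \<in> analytic_space lam"
  shows "analytic_norm lam g = ereal (N g)"
  using assms analytic_norm_nonneg[of g] unfolding N_def analytic_space_def
  by (auto simp: ereal_real')

lemma analytic_spaceD:
  assumes "g \<in> analytic_space lam" "is_strip_extension B g h" "z \<in> strip B"
  shows "cmod (h z) \<le> N g * exp (L \<bar>Im z\<bar>)"
  using analytic_norm_le_iff[OF assms(2), of "N g"] analytic_norm_eq_N[OF assms(1)] assms(3) by simp

text \<open>Continuity of \<open>g\<close> comes from that of \<open>h\<close>, and finiteness of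
  the norm from the bound. One pointwise estimate thus yields membership and a norm bound
  together.\<close>

lemma analytic_spaceI:
  assumes "\<And>x. g (x + 2 * pi) = g x" "is_strip_extension B g h"
    and "\<And>z. z \<in> strip B \<Longrightarrow> cmod (h z) \<le> K * exp (L \<bar>Im z\<bar>)"
  shows "g \<in> analytic_space lam \<and> N g \<le> K"
proof -
  have "continuous_on UNIV (\<lambda>x. h (of_real x))"
    by (rule continuous_on_compose2[OF holomorphic_on_imp_continuous_on[of h "strip B"]])
       (use assms(2) in \<open>auto intro!: continuous_intros of_real_in_strip growth_bound_pos simp: is_strip_extension_def\<close>)
  then have "g \<in> periodic_cont"
    using assms(1,2) by (simp add: periodic_cont_def is_strip_extension_def)
  moreover have le: "analytic_norm lam g \<le> ereal K"
    using analytic_norm_le_iff[OF assms(2)] assms(3) by blast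
  ultimately have g: "g \<in> analytic_space lam"
    using assms(2) by (auto simp: analytic_space_def)
  with le show ?thesis
    by (simp add: analytic_norm_eq_N)
qed

lemma analytic_space_extension:
  assumes "g \<in> analytic_space lam"
  obtains h where "is_strip_extension B g h" "h holomorphic_on strip B"
    "g = (\<lambda>x. h (of_real x))" "\<And>z. z \<in> strip B \<Longrightarrow> h (z + 2 * of_real pi) = h z"
proof -
  obtain h where h: "is_strip_extension B g h"
    using assms by (auto simp: analytic_space_def)
  then have eq: "g = (\<lambda>x. h (of_real x))" and hol: "h holomorphic_on strip B"
    by (auto simp: is_strip_extension_def)
  moreover have "h (of_real (x + 2 * pi)) = h (of_real x)" for x
    using assms fun_cong[OF eq, of x] fun_cong[OF eq, of "x + 2 * pi"]
    by (simp add: analytic_space_def periodic_cont_def del: of_real_add)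
  ultimately show ?thesis
    using that h strip_periodic[OF growth_bound_pos hol] by blast
qed

lemma analytic_space_continuous: "g \<in> analytic_space lam \<Longrightarrow> continuous_on UNIV g"
  by (simp add: analytic_space_def periodic_cont_def)

lemma analytic_space_periodic: "g \<in> analytic_space lam \<Longrightarrow> g (x + 2 * pi) = g x"
  by (simp add: analytic_space_def periodic_cont_def)

section \<open>Linear structure and norm axioms\<close>

lemma is_strip_extension_lin:
  assumes "is_strip_extension B f h" "is_strip_extension B g k"
  shows "is_strip_extension B (fun_scale c f + g) (\<lambda>z. c * h z + k z)"
  using assms by (auto simp: is_strip_extension_def fun_scale_def intro!: holomorphic_intros)

lemma is_strip_extension_0: "is_strip_extension B 0 (\<lambda>_. 0)"
  by (simp add: is_strip_extension_def)

lemma analytic_space_0: "0 \<in> analytic_space lam" "N 0 = 0"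
proof -
  have "0 \<in> analytic_space lam \<and> N 0 \<le> 0"
    by (rule analytic_spaceI[OF _ is_strip_extension_0]) auto
  then show "0 \<in> analytic_space lam" "N 0 = 0"
    using N_nonneg[of 0] by auto
qed

text \<open>One estimate serves addition (\<open>c = 1\<close>), scaling (\<open>g = 0\<close>),
  subtraction (\<open>c = -1\<close>) and the triangle inequality.\<close>

lemma analytic_space_lin:
  assumes "f \<in> analytic_space lam" "g \<in> analytic_space lam"
  shows "fun_scale c f + g \<in> analytic_space lam \<and> N (fun_scale c f + g) \<le> cmod c * N f + N g"
proof -
  obtain h k where h: "is_strip_extension B f h" and k: "is_strip_extension B g k"
    using assms by (metis analytic_space_extension)
  show ?thesis
  proof (rule analytic_spaceI[OF _ is_strip_extension_lin[OF h k]])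
    fix z assume z: "z \<in> strip B"
    have "cmod (c * h z + k z) \<le> cmod c * cmod (h z) + cmod (k z)"
      by (metis norm_mult norm_triangle_ineq)
    also have "\<dots> \<le> cmod c * (N f * exp (L \<bar>Im z\<bar>)) + N g * exp (L \<bar>Im z\<bar>)"
      using analytic_spaceD assms h k z by (intro add_mono mult_left_mono) auto
    finally show "cmod (c * h z + k z) \<le> (cmod c * N f + N g) * exp (L \<bar>Im z\<bar>)"
      by (simp add: algebra_simps)
  qed (use assms in \<open>simp add: fun_scale_def analytic_space_periodic\<close>)
qed

lemma analytic_space_scale:
  assumes "f \<in> analytic_space lam"
  shows "fun_scale c f \<in> analytic_space lam" "N (fun_scale c f) = cmod c * N f"
proof -
  have le: "fun_scale c f \<in> analytic_space lam \<and> N (fun_scale c f) \<le> cmod c * N f"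
    if "f \<in> analytic_space lam" for c f
    using analytic_space_lin[OF that analytic_space_0(1), of c] analytic_space_0(2) by simp
  show "fun_scale c f \<in> analytic_space lam"
    using le[OF assms] by simp
  show "N (fun_scale c f) = cmod c * N f"
  proof (cases "c = 0")
    case True
    then have "fun_scale c f = 0"
      by (auto simp: fun_scale_def)
    with True analytic_space_0 show ?thesis by simp
  next
    case False
    \<comment> \<open>Applying the upper bound to the inverse scaling gives the reverse
      inequality.\<close>
    have "f = fun_scale (1 / c) (fun_scale c f)"
      using False by (simp add: fun_scale_def)
    then have "N f \<le> cmod (1 / c) * N (fun_scale c f)"
      by (metis le[OF assms, of c] le[of "fun_scale c f" "1 / c"])
    with False have "cmod c * N f \<le> N (fun_scale c f)"
      by (simp add: norm_divide field_simps)
    with le[OF assms, of c] show ?thesis by simp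
  qed
qed

lemma analytic_space_diff:
  assumes "f \<in> analytic_space lam" "g \<in> analytic_space lam"
  shows "f - g \<in> analytic_space lam"
proof -
  have "f - g = fun_scale (-1) g + f"
    by (simp add: fun_scale_def fun_eq_iff)
  then show ?thesis
    using analytic_space_lin[OF assms(2,1), of "-1"] by simp
qed

lemma is_strip_extension_diff:
  assumes "is_strip_extension B f h" "is_strip_extension B g k"
  shows "is_strip_extension B (f - g) (\<lambda>z. h z - k z)"
  using assms by (auto simp: is_strip_extension_def intro!: holomorphic_intros)

text \<open>Both functions get the same arbitrary \<^const>\<open>strip_extension\<close> if there is none, so this
  holds without any assumption.  The locale \<^locale>\<open>Metric_space\<close> requires symmetry on the whole type.\<close>

lemma N_minus: "N (- g) = N g"
proof -
  have ext: "is_strip_extension B (- f) (\<lambda>z. - h z)" if "is_strip_extension B f h" for f h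
    using that by (auto simp: is_strip_extension_def intro!: holomorphic_intros)
  show ?thesis
  proof (cases "\<exists>h. is_strip_extension B g h")
    case True
    then obtain h where h: "is_strip_extension B g h" ..
    show ?thesis
      unfolding N_def analytic_norm_eq[OF h] analytic_norm_eq[OF ext[OF h]] by simp
  next
    case False
    moreover from this have "\<not> is_strip_extension B (- g) h" for h
      using ext[of "- g" h] by auto
    ultimately have "strip_extension B (- g) = strip_extension B g"
      by (simp add: strip_extension_def)
    then show ?thesis
      by (simp add: N_def analytic_norm_def)
  qed
qed

lemma N_eq_0_iff:
  assumes "f \<in> analytic_space lam"
  shows "N f = 0 \<longleftrightarrow> f = 0"
proof
  assume 0: "N f = 0"
  obtain h where h: "is_strip_extension B f h" "f = (\<lambda>x. h (of_real x))"
    using analytic_space_extension[OF assms] by metis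
  show "f = 0"
    using analytic_spaceD[OF assms h(1) of_real_in_strip[OF growth_bound_pos]] 0 h(2) by auto
qed (simp add: analytic_space_0)

section \<open>The induced metric and its completeness\<close>

lemma metric_space: "Metric_space (analytic_space lam) (\<lambda>f g. N (f - g))"
proof
  show "N (f - g) = N (g - f)" for f g
    using N_minus[of "f - g"] by simp
  show "N (f - g) = 0 \<longleftrightarrow> f = g" if "f \<in> analytic_space lam" "g \<in> analytic_space lam" for f g
    using N_eq_0_iff[OF analytic_space_diff[OF that]] by simp
  show "N (f - k) \<le> N (f - g) + N (g - k)"
    if "f \<in> analytic_space lam" "g \<in> analytic_space lam" "k \<in> analytic_space lam" for f g k
  proof -
    have "fun_scale 1 (f - g) + (g - k) = f - k"
      by (simp add: fun_scale_def fun_eq_iff)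
    then show ?thesis
      using analytic_space_lin[of "f - g" "g - k" 1] analytic_space_diff that by auto
  qed
qed (rule N_nonneg)

text \<open>As \<open>L\<close> is monotone, the weight \<open>exp (L \<bar>Im w\<bar>)\<close> is
  at most \<open>exp (L R)\<close> on a closed disc inside the strip. Convergence in the weighted
  norm is therefore uniform there, which is what the Weierstrass theorem on limits of holomorphic
  functions requires.\<close>

lemma locally_uniform_limit:
  assumes lim: "\<And>\<epsilon>. \<epsilon> > 0 \<Longrightarrow> \<exists>M. \<forall>n\<ge>M. \<forall>z\<in>strip B. cmod (H n z - G z) \<le> \<epsilon> * exp (L \<bar>Im z\<bar>)"
    and z: "z \<in> strip B"
  shows "\<exists>d>0. cball z d \<subseteq> strip B \<and> uniform_limit (cball z d) H G sequentially"
proof -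
  obtain d where d: "d > 0" "cball z d \<subseteq> strip B"
    using open_strip z by (meson open_contains_cball)
  define R where "R = \<bar>Im z\<bar> + d"
  \<comment> \<open>A point of the disc farthest from the real axis; that it lies in the strip shows
    \<open>R < B\<close>.\<close>
  define w where "w = (if Im z \<ge> 0 then z + \<i> * of_real d else z - \<i> * of_real d)"
  have "w \<in> cball z d" and "\<bar>Im w\<bar> = R"
    using d(1) by (auto simp: w_def R_def dist_norm norm_mult)
  then have R: "ereal R < B"
    using d(2) by (auto simp: strip_def)
  have "uniform_limit (cball z d) H G sequentially"
  proof (rule uniform_limitI)
    fix e :: real assume e: "e > 0"
    then obtain M where M: "\<And>n w. n \<ge> M \<Longrightarrow> w \<in> strip B \<Longrightarrow>
        cmod (H n w - G w) \<le> e / 2 * exp (- L R) * exp (L \<bar>Im w\<bar>)"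
      using lim[of "e / 2 * exp (- L R)"] by auto
    have "dist (H n w) (G w) < e" if "n \<ge> M" "w \<in> cball z d" for n w
    proof -
      have "\<bar>Im w - Im z\<bar> \<le> d"
        using abs_Im_le_cmod[of "z - w"] that(2) by (simp add: dist_norm)
      then have "L \<bar>Im w\<bar> \<le> L R"
        using R by (intro L_mono) (auto simp: R_def)
      then have "e / 2 * exp (- L R) * exp (L \<bar>Im w\<bar>) \<le> e / 2 * exp (- L R) * exp (L R)"
        using e by (intro mult_left_mono) auto
      also have "\<dots> < e"
        using e by (simp add: exp_minus)
      finally show ?thesis
        using M[of n w] that d(2) by (auto simp: dist_norm)
    qed
    then show "\<forall>\<^sub>F n in sequentially. \<forall>w\<in>cball z d. dist (H n w) (G w) < e"
      unfolding eventually_sequentially by blast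
  qed
  with d show ?thesis by blast
qed

text \<open>The extensions of a Cauchy sequence converge pointwise on the strip, and the weighted
  Cauchy estimate survives the limit. The limit is holomorphic by locally uniform convergence, and
  its restriction to the real axis is the limit in norm.\<close>

lemma mcomplete: "Metric_space.mcomplete (analytic_space lam) (\<lambda>f g. N (f - g))"
proof -
  interpret Metric_space "analytic_space lam" "\<lambda>f g. N (f - g)"
    by (rule metric_space)
  show ?thesis
    unfolding mcomplete_def
  proof (intro allI impI)
    fix \<sigma> assume "MCauchy \<sigma>"
    then have mem: "\<sigma> n \<in> analytic_space lam"
      and cauchy: "\<epsilon> > 0 \<Longrightarrow> \<exists>M. \<forall>n n'. M \<le> n \<longrightarrow> M \<le> n' \<longrightarrow> N (\<sigma> n - \<sigma> n') < \<epsilon>" for n \<epsilon>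
      by (auto simp: MCauchy_def)
    have "\<forall>n. \<exists>h. is_strip_extension B (\<sigma> n) h"
      using mem by (metis analytic_space_extension)
    then obtain H where H: "\<And>n. is_strip_extension B (\<sigma> n) (H n)"
      by metis
    have H_diff: "cmod (H n z - H n' z) \<le> N (\<sigma> n - \<sigma> n') * exp (L \<bar>Im z\<bar>)" if "z \<in> strip B" for n n' z
      using analytic_spaceD[OF analytic_space_diff[OF mem mem] is_strip_extension_diff[OF H H] that] .
    \<comment> \<open>Outside the strip \<open>lim\<close> may be arbitrary; only its values on the
      strip enter.\<close>
    define G where "G = (\<lambda>z. lim (\<lambda>n. H n z))"
    have G: "(\<lambda>n. H n z) \<longlonglongrightarrow> G z" if z: "z \<in> strip B" for z
    proof -
      have "Cauchy (\<lambda>n. H n z)"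
      proof (rule CauchyI)
        fix e :: real assume "e > 0"
        then obtain M where M: "\<And>n n'. M \<le> n \<Longrightarrow> M \<le> n' \<Longrightarrow> N (\<sigma> n - \<sigma> n') < e * exp (- L \<bar>Im z\<bar>)"
          using cauchy[of "e * exp (- L \<bar>Im z\<bar>)"] by auto
        have "norm (H n z - H n' z) < e" if "M \<le> n" "M \<le> n'" for n n'
        proof -
          have "N (\<sigma> n - \<sigma> n') * exp (L \<bar>Im z\<bar>) < e * exp (- L \<bar>Im z\<bar>) * exp (L \<bar>Im z\<bar>)"
            using M[OF that] by (intro mult_strict_right_mono) auto
          then show ?thesis
            using H_diff[OF z, of n n'] by (simp add: mult.assoc flip: exp_add)
        qed
        then show "\<exists>M. \<forall>m\<ge>M. \<forall>n\<ge>M. norm (H m z - H n z) < e"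
          by blast
      qed
      then show ?thesis
        unfolding G_def by (simp add: Cauchy_convergent convergent_LIMSEQ_iff[symmetric])
    qed
    have unif: "\<exists>M. \<forall>n\<ge>M. \<forall>z\<in>strip B. cmod (H n z - G z) \<le> \<epsilon> * exp (L \<bar>Im z\<bar>)"
      if \<epsilon>: "\<epsilon> > 0" for \<epsilon>
    proof -
      obtain M where M: "\<And>n n'. M \<le> n \<Longrightarrow> M \<le> n' \<Longrightarrow> N (\<sigma> n - \<sigma> n') < \<epsilon>"
        using cauchy[OF \<epsilon>] by auto
      \<comment> \<open>\<open>M\<close> does not depend on \<open>z\<close>: the estimate for
        \<open>H n z - H n' z\<close> is uniform in \<open>n'\<close>, and \<open>n'\<close> tends
        to infinity.\<close>
      have "cmod (H n z - G z) \<le> \<epsilon> * exp (L \<bar>Im z\<bar>)" if n: "n \<ge> M" and z: "z \<in> strip B" for n z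
      proof (rule tendsto_upperbound)
        show "(\<lambda>n'. cmod (H n z - H n' z)) \<longlonglongrightarrow> cmod (H n z - G z)"
          by (intro tendsto_intros G z)
        have "cmod (H n z - H n' z) \<le> \<epsilon> * exp (L \<bar>Im z\<bar>)" if "n' \<ge> M" for n'
          using H_diff[OF z, of n n'] M[OF n that]
          by (smt (verit) exp_gt_zero mult_right_mono)
        then show "\<forall>\<^sub>F n' in sequentially. cmod (H n z - H n' z) \<le> \<epsilon> * exp (L \<bar>Im z\<bar>)"
          by (auto simp: eventually_sequentially)
      qed simp
      then show ?thesis by blast
    qed
    have "G holomorphic_on strip B"
    proof (rule holomorphic_uniform_sequence[OF open_strip])
      show "H n holomorphic_on strip B" for n
        using H by (simp add: is_strip_extension_def)
    qed (rule locally_uniform_limit[OF unif])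
    define g where "g = (\<lambda>x. G (complex_of_real x))"
    have ext: "is_strip_extension B g G"
      using \<open>G holomorphic_on strip B\<close> by (simp add: is_strip_extension_def g_def)
    have lim: "(\<lambda>n. \<sigma> n x) \<longlonglongrightarrow> g x" for x
      using G[OF of_real_in_strip[OF growth_bound_pos, of x]] H by (simp add: g_def is_strip_extension_def)
    have per: "g (x + 2 * pi) = g x" for x
      using LIMSEQ_unique[OF lim[of "x + 2 * pi"]] lim[of x] by (simp add: analytic_space_periodic[OF mem])
    have g: "g \<in> analytic_space lam"
    proof -
      \<comment> \<open>One member of the sequence within weighted distance 1 of \<open>G\<close>
        suffices to bound \<open>G\<close>.\<close>
      obtain n where n: "\<And>z. z \<in> strip B \<Longrightarrow> cmod (H n z - G z) \<le> 1 * exp (L \<bar>Im z\<bar>)"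
        using unif[of 1] by auto
      have "cmod (G z) \<le> (N (\<sigma> n) + 1) * exp (L \<bar>Im z\<bar>)" if z: "z \<in> strip B" for z
        using n[OF z] analytic_spaceD[OF mem H z, of n] norm_triangle_ineq4[of "H n z" "H n z - G z"]
        by (simp add: algebra_simps)
      then show ?thesis
        using analytic_spaceI[OF per ext] by blast
    qed
    have "\<forall>\<^sub>F n in sequentially. N (\<sigma> n - g) < e" if e: "e > 0" for e
    proof -
      obtain M where M: "\<And>n z. n \<ge> M \<Longrightarrow> z \<in> strip B \<Longrightarrow> cmod (H n z - G z) \<le> e / 2 * exp (L \<bar>Im z\<bar>)"
        using unif[of "e / 2"] e by auto
      have "N (\<sigma> n - g) < e" if "n \<ge> M" for n
      proof -
        \<comment> \<open>Pointwise bounds give only a weak inequality for the supremum; aiming at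
          \<open>e / 2\<close> makes the final one strict.\<close>
        have "N (\<sigma> n - g) \<le> e / 2"
          using analytic_spaceI[OF _ is_strip_extension_diff[OF H ext] M[OF that]]
          by (simp add: per analytic_space_periodic[OF mem])
        with e show ?thesis by simp
      qed
      then show ?thesis
        by (auto simp: eventually_sequentially)
    qed
    then show "\<exists>g. limitin mtopology \<sigma> g sequentially"
      using g mem by (auto simp: limitin_metric)
  qed
qed

lemma complex_banach_on_analytic_space:
  "complex_banach_on fun_scale (analytic_space lam) N"
  unfolding complex_banach_on_def
proof (intro conjI ballI allI)
  have add: "f + g \<in> analytic_space lam \<and> N (f + g) \<le> N f + N g"
    if "f \<in> analytic_space lam" "g \<in> analytic_space lam" for f g
  proof -
    have "fun_scale 1 f + g = f + g"
      by (simp add: fun_scale_def)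
    then show ?thesis
      using analytic_space_lin[OF that, of 1] by simp
  qed
  then show "N (f + g) \<le> N f + N g"
    if "f \<in> analytic_space lam" "g \<in> analytic_space lam" for f g
    using that by blast
  show "fun_space.subspace (analytic_space lam)"
    using add analytic_space_0 analytic_space_scale by (auto simp: fun_space.subspace_def)
qed (auto simp: vector_space_fun_scale N_nonneg N_eq_0_iff analytic_space_scale mcomplete)

section \<open>The conjugate and the decay of Fourier coefficients\<close>

text \<open>The factor \<open>exp (- \<lambda>*(s))\<close> as a real number. It is 0 where the
  conjugate is infinite, and \<open>exp_ereal_eq_E\<close> shows that the conversion loses
  nothing.\<close>

definition E :: "real \<Rightarrow> real" where "E s = real_of_ereal (exp_ereal (- fenchel lam s))"

lemma fenchel_ge: "0 \<le> r \<Longrightarrow> ereal r < B \<Longrightarrow> ereal (r * s - L r) \<le> fenchel lam s"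
  unfolding fenchel_def by (rule SUP_upper2[of r]) (auto simp: lam_eq_L)

text \<open>The endpoint \<open>r = B\<close> may contribute to the supremum, but monotonicity of \<open>lam\<close> makes it
  a limit of the contributions of \<open>r < B\<close>.\<close>

lemma fenchel_le:
  assumes "\<And>r. 0 \<le> r \<Longrightarrow> ereal r < B \<Longrightarrow> r * s - L r \<le> C"
  shows "fenchel lam s \<le> ereal C"
  unfolding fenchel_def
proof (rule SUP_least)
  fix r :: real assume "r \<in> {0..}"
  then have r: "0 \<le> r" by simp
  consider "ereal r < B" | "lam r = \<infinity>" | "lam r \<noteq> \<infinity>" "B \<le> ereal r"
    by force
  then show "ereal (r * s) - lam r \<le> ereal C"
  proof cases
    case 1
    then show ?thesis
      using assms[OF r] lam_eq_L[OF r] by simp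
  next
    case 3
    then have "ereal r \<le> B"
      unfolding growth_bound_def using r by (intro Sup_upper) (auto simp: less_top)
    with 3 have B: "B = ereal r" by simp
    then have "0 < r"
      using growth_bound_pos by simp
    have lam_r: "lam r = ereal (L r)"
      using 3 not_MInf[OF r] by (cases "lam r") (auto simp: L_def)
    have "t * s - L r \<le> C" if t: "0 < t" "t < r" for t
    proof -
      have "lam t \<le> lam r"
        using t by (intro mono_onD[OF mono_lam]) auto
      then have "L t \<le> L r"
        using t B lam_eq_L[of t] lam_r by simp
      then show ?thesis
        using assms[of t] t B by simp
    qed
    then have "\<forall>\<^sub>F t in at_left r. t * s - L r \<le> C"
      using \<open>0 < r\<close> by (auto simp: eventually_at_left_field)
    then have "r * s - L r \<le> C"
      by (intro tendsto_upperbound[of "\<lambda>t. t * s - L r" _ "at_left r"] tendsto_intros) auto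
    then show ?thesis
      by (simp add: lam_r)
  qed simp
qed

lemma exp_ereal_eq_E: "exp_ereal (- fenchel lam s) = ereal (E s)"
  and E_nonneg: "0 \<le> E s"
proof -
  have "fenchel lam s \<noteq> -\<infinity>"
    using fenchel_ge[of 0 s] growth_bound_pos by (auto simp: zero_ereal_def)
  then show "exp_ereal (- fenchel lam s) = ereal (E s)" "0 \<le> E s"
    by (cases "fenchel lam s"; simp add: E_def)+
qed

text \<open>Optimises a family of bounds over the height \<open>r\<close>: after taking logarithms,
  the hypotheses say exactly that \<open>ln K - ln a\<close> bounds the conjugate. For positive
  \<open>a\<close> this also forces the conjugate to be finite.\<close>

lemma le_E_mult:
  assumes K: "0 \<le> K" and le: "\<And>r. 0 \<le> r \<Longrightarrow> ereal r < B \<Longrightarrow> a \<le> K * exp (L r - r * s)"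
  shows "a \<le> E s * K"
proof (cases "a \<le> 0")
  case True
  moreover have "0 \<le> E s * K"
    using K E_nonneg by simp
  ultimately show ?thesis by linarith
next
  case False
  then have "0 < a" by simp
  have B0: "ereal 0 < B"
    using growth_bound_pos by (simp add: zero_ereal_def)
  have "K \<noteq> 0"
    using le[of 0] \<open>0 < a\<close> B0 by auto
  with K have "0 < K" by simp
  have "fenchel lam s \<le> ereal (ln K - ln a)"
  proof (rule fenchel_le)
    fix r :: real assume r: "0 \<le> r" "ereal r < B"
    have "ln a \<le> ln (K * exp (L r - r * s))"
      using le[OF r] \<open>0 < a\<close> by simp
    then show "r * s - L r \<le> ln K - ln a"
      using \<open>0 < K\<close> by (simp add: ln_mult)
  qed
  moreover have "fenchel lam s \<noteq> -\<infinity>"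
    using fenchel_ge[of 0 s] B0 by auto
  ultimately obtain f where f: "fenchel lam s = ereal f" "f \<le> ln K - ln a"
    by (cases "fenchel lam s") auto
  have "a = exp (- (ln K - ln a)) * K"
    using \<open>0 < a\<close> \<open>0 < K\<close> by (simp add: exp_diff)
  also have "\<dots> \<le> exp (- f) * K"
    using f(2) \<open>0 < K\<close> by (intro mult_right_mono) auto
  finally show ?thesis
    by (simp add: E_def f(1))
qed

lemma norm_fourier_coeff_le_E:
  assumes g: "g \<in> analytic_space lam"
  shows "cmod (fourier_coeff g n) \<le> E \<bar>of_int n\<bar> * N g"
proof (rule le_E_mult[OF N_nonneg])
  fix r :: real assume r: "0 \<le> r" "ereal r < B"
  obtain h where h: "is_strip_extension B g h" "h holomorphic_on strip B"
    "g = (\<lambda>x. h (of_real x))" "\<And>z. z \<in> strip B \<Longrightarrow> h (z + 2 * of_real pi) = h z"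
    using analytic_space_extension[OF g] by metis
  \<comment> \<open>The sign opposite to that of \<open>n\<close> turns the factor
    \<open>exp (n * y)\<close> into \<open>exp (- r * \<bar>n\<bar>)\<close>.\<close>
  define y where "y = (if n \<ge> 0 then - r else r)"
  have y: "\<bar>y\<bar> = r" "of_int n * y = - (r * \<bar>of_int n\<bar>)"
    using r by (auto simp: y_def)
  have "cmod (fourier_coeff (\<lambda>x. h (of_real x)) n) \<le> N g * exp (L r) * exp (of_int n * y)"
  proof (rule norm_fourier_coeff_strip_le[OF h(2,4)])
    show "cmod (h (of_real x + \<i> * of_real y)) \<le> N g * exp (L r)" for x
      using analytic_spaceD[OF g h(1), of "of_real x + \<i> * of_real y"] r y(1) by (simp add: strip_def)
  qed (use r y in auto)
  then show "cmod (fourier_coeff g n) \<le> N g * exp (L r - r * \<bar>of_int n\<bar>)"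
    by (simp add: h(3)[symmetric] y(2) mult.assoc flip: exp_add)
qed

text \<open>For large \<open>m\<close> only \<open>r \<ge> r0\<close> matter in the supremum defining the conjugate at \<open>m\<close>,
  so beyond \<open>m\<close> the conjugate grows with slope at least \<open>r0\<close>.\<close>

lemma E_decay:
  obtains r0 :: real and m0 :: nat where "r0 > 0"
    and "\<And>m k. m \<ge> m0 \<Longrightarrow> E (real (m + k)) \<le> exp (- r0) ^ k * E (real m)"
proof -
  obtain r1 where r1: "0 < r1" "ereal r1 < B"
    using growth_bound_pos ereal_dense2[of 0 B] by (auto simp: zero_ereal_def)
  \<comment> \<open>Halving makes the gap \<open>r1 - r0\<close> equal to \<open>r0\<close>. For
    \<open>m \<ge> m0\<close>, the gain \<open>r0 * m\<close> from replacing \<open>r0\<close> by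
    \<open>r1\<close> then outweighs the cost \<open>L r1 - L 0\<close>.\<close>
  define r0 where "r0 = r1 / 2"
  obtain m0 :: nat where m0: "(L r1 - L 0) / r0 \<le> real m0"
    using real_arch_simple by blast
  have "E (real (m + k)) \<le> exp (- r0) ^ k * E (real m)" if m: "m \<ge> m0" for m k
  proof (cases "fenchel lam (real (m + k))")
    case (real C)
    have "L r1 - L 0 \<le> r0 * real m"
      using m0 m r1 by (simp add: r0_def field_simps) (smt (verit) mult_left_mono of_nat_mono)
    then have r1m: "r0 * real m - L 0 \<le> r1 * real m - L r1"
      by (simp add: r0_def)
    have C: "r * real (m + k) - L r \<le> C" if "0 \<le> r" "ereal r < B" for r
      using fenchel_ge[OF that, of "real (m + k)"] real by simp
    have "fenchel lam (real m) \<le> ereal (C - r0 * real k)"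
    proof (rule fenchel_le)
      fix r assume r: "0 \<le> r" "ereal r < B"
      show "r * real m - L r \<le> C - r0 * real k"
      proof (cases "r0 \<le> r")
        case True
        then have "r0 * real k \<le> r * real k"
          by (intro mult_right_mono) auto
        with C[OF r] show ?thesis
          by (simp add: algebra_simps)
      next
        \<comment> \<open>A small \<open>r\<close> is beaten by \<open>r1\<close>: its contribution
          is at most \<open>r0 * m - L 0 \<le> r1 * m - L r1 \<le> C - r1 * k\<close>.\<close>
        case False
        then have "r * real m \<le> r0 * real m"
          by (intro mult_right_mono) auto
        moreover have "L 0 \<le> L r"
          using r by (intro L_mono) auto
        moreover have "r0 * real k \<le> r1 * real k"
          using r1 by (intro mult_right_mono) (auto simp: r0_def)
        ultimately show ?thesis
          using C[of r1] r1 r1m by (simp add: algebra_simps)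
      qed
    qed
    then have *: "exp (- (C - r0 * real k)) \<le> E (real m)"
      using fenchel_ge[of 0 "real m"] growth_bound_pos
      by (cases "fenchel lam (real m)") (auto simp: E_def zero_ereal_def)
    have "E (real (m + k)) = exp (- C)"
      by (simp only: E_def real) simp
    also have "\<dots> = exp (- (r0 * real k)) * exp (- (C - r0 * real k))"
      by (simp flip: exp_add)
    also have "\<dots> \<le> exp (- (r0 * real k)) * E (real m)"
      by (intro mult_left_mono) (use * in auto)
    also have "exp (- (r0 * real k)) = exp (- r0) ^ k"
      by (simp add: mult.commute flip: exp_of_nat_mult)
    finally show ?thesis .
  next
    case PInf
    then have "E (real (m + k)) = 0"
      by (simp only: E_def) simp
    then show ?thesis
      using E_nonneg by simp
  next
    case MInf
    then show ?thesis
      using fenchel_ge[of 0 "real (m + k)"] growth_bound_pos by (auto simp: zero_ereal_def)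
  qed
  moreover have "r0 > 0"
    using r1 by (simp add: r0_def)
  ultimately show ?thesis
    using that by blast
qed

text \<open>The frequencies \<open>m + k\<close> and \<open>-(m + k)\<close> each contribute at most
  \<open>q ^ k * E m * N g\<close>. Summing the geometric series gives
  \<open>c = 2 * q / (1 - q)\<close>, and pointwise convergence of the partial sums identifies the
  tail with the error.\<close>

lemma fourier_sum_error:
  obtains c :: real and m0 :: nat where "c > 0"
    and "\<And>g m x. g \<in> analytic_space lam \<Longrightarrow> m \<ge> m0 \<Longrightarrow>
      cmod (g x - fourier_sum m g x) \<le> c * E (real m) * N g"
proof -
  obtain r0 m0 where r0: "r0 > 0"
    and decay: "\<And>m k. m \<ge> m0 \<Longrightarrow> E (real (m + k)) \<le> exp (- r0) ^ k * E (real m)"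
    using E_decay by metis
  define q where "q = exp (- r0)"
  have q: "0 < q" "q < 1"
    using r0 by (auto simp: q_def)
  \<comment> \<open>The sum of \<open>q ^ k\<close> over \<open>k \<ge> 1\<close>; its partial sums
    are \<open>D * (1 - q ^ j)\<close>, the exact form in which the induction for
    \<open>part\<close> closes.\<close>
  define D where "D = q / (1 - q)"
  have D: "D > 0"
    using q by (simp add: D_def)
  have "cmod (g x - fourier_sum m g x) \<le> 2 * D * E (real m) * N g"
    if g: "g \<in> analytic_space lam" and m: "m \<ge> m0" for g m x
  proof -
    let ?K = "2 * E (real m) * N g"
    have K: "0 \<le> ?K"
      by (simp add: E_nonneg N_nonneg)
    have coeff: "cmod (fourier_coeff g n) \<le> q ^ k * E (real m) * N g"
      if "\<bar>of_int n\<bar> = real (m + k)" for n k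
    proof -
      have "cmod (fourier_coeff g n) \<le> E (real (m + k)) * N g"
        using norm_fourier_coeff_le_E[OF g, of n] that by simp
      also have "\<dots> \<le> q ^ k * E (real m) * N g"
        using decay[OF m, of k] N_nonneg unfolding q_def by (intro mult_right_mono) auto
      finally show ?thesis .
    qed
    have part: "cmod (fourier_sum (m + j) g x - fourier_sum m g x) \<le> ?K * (D * (1 - q ^ j))" for j
    proof (induction j)
      case (Suc j)
      let ?a = "\<lambda>n::int. fourier_coeff g n * exp (\<i> * of_int n * of_real x)"
      have a: "cmod (?a n) \<le> q ^ Suc j * E (real m) * N g" if "\<bar>of_int n\<bar> = real (m + Suc j)" for n
        using coeff[OF that] by (simp add: norm_mult)
      have "fourier_sum (m + Suc j) g x - fourier_sum m g x =
          (fourier_sum (m + j) g x - fourier_sum m g x)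
            + ?a (int (m + Suc j)) + ?a (- int (m + Suc j))"
        using fourier_sum_Suc[of "m + j" g x] by simp
      also have "cmod \<dots> \<le> cmod (fourier_sum (m + j) g x - fourier_sum m g x)
            + cmod (?a (int (m + Suc j))) + cmod (?a (- int (m + Suc j)))"
        by (intro norm_triangle_le add_right_mono norm_triangle_ineq)
      also have "\<dots> \<le> ?K * (D * (1 - q ^ j)) + q ^ Suc j * E (real m) * N g + q ^ Suc j * E (real m) * N g"
        by (intro add_mono Suc.IH a) auto
      also have "\<dots> = ?K * (D * (1 - q ^ j) + q ^ Suc j)"
        by (simp add: algebra_simps)
      also have "D * (1 - q ^ j) + q ^ Suc j = D * (1 - q ^ Suc j)"
        using q by (simp add: D_def field_simps)
      finally show ?case .
    qed simp
    have bound: "cmod (fourier_sum (m + j) g x - fourier_sum m g x) \<le> ?K * D" for j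
    proof -
      have "?K * (D * (1 - q ^ j)) \<le> ?K * (D * 1)"
        using K D q by (intro mult_left_mono) auto
      with part[of j] show ?thesis by simp
    qed
    obtain h where h: "h holomorphic_on strip B" "g = (\<lambda>x. h (of_real x))"
      "\<And>z. z \<in> strip B \<Longrightarrow> h (z + 2 * of_real pi) = h z"
      using analytic_space_extension[OF g] by metis
    have "(\<lambda>j. fourier_sum j g x) \<longlonglongrightarrow> g x"
      using fourier_sum_tendsto[OF growth_bound_pos h(1,3), of x] by (simp add: h(2))
    then have "(\<lambda>j. fourier_sum (m + j) g x) \<longlonglongrightarrow> g x"
      by (subst add.commute) (rule LIMSEQ_ignore_initial_segment)
    then have "(\<lambda>j. cmod (fourier_sum (m + j) g x - fourier_sum m g x)) \<longlonglongrightarrow> cmod (g x - fourier_sum m g x)"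
      by (intro tendsto_intros)
    then have "cmod (g x - fourier_sum m g x) \<le> ?K * D"
      by (rule tendsto_upperbound) (auto simp: bound)
    then show ?thesis
      by (simp add: mult_ac)
  qed
  with D show ?thesis
    using that[of "2 * D" m0] by simp
qed

end

theorem theorem3p2:
  fixes lam :: "real \<Rightarrow> ereal"
  assumes "\<And>r. 0 \<le> r \<Longrightarrow> lam r \<noteq> -\<infinity>"
    and "mono_on {0..} lam"
    and "growth_bound lam > 0"
  shows "complex_banach_on fun_scale (analytic_space lam) (\<lambda>g. real_of_ereal (analytic_norm lam g)) \<and>
    (\<forall>g\<in>analytic_space lam. \<forall>n::int.
       ereal (cmod (fourier_coeff g n))
         \<le> exp_ereal (- fenchel lam \<bar>real_of_int n\<bar>) * analytic_norm lam g) \<and>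
    (\<exists>c::real. c > 0 \<and>
      (\<exists>m0::nat. \<forall>g\<in>analytic_space lam. \<forall>m\<ge>m0.
         Linf_norm (g - trig_proj m g)
           \<le> ereal (2 * c) * exp_ereal (- fenchel lam (real m)) * analytic_norm lam g) \<and>
      (\<exists>\<delta>0::real. \<delta>0 > 0 \<and> (\<forall>g\<in>analytic_space lam. \<forall>\<delta>. 0 < \<delta> \<and> \<delta> \<le> \<delta>0 \<longrightarrow>
         Linf_norm g
           \<le> ereal c * exp_ereal (- fenchel lam (of_int \<lfloor>pi / \<delta> - 1 / 2\<rfloor>)) * analytic_norm lam g
             + ereal (1 / \<delta> * L1_norm g))))"
proof -
  interpret growth_function lam
    by standard (use assms in auto)
  obtain c m0 where c: "c > 0" and err: "\<And>g m x. g \<in> analytic_space lam \<Longrightarrow> m \<ge> m0 \<Longrightarrow>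
      cmod (g x - fourier_sum m g x) \<le> c * E (real m) * N g"
    using fourier_sum_error by metis
  have "Linf_norm (g - trig_proj m g)
      \<le> ereal (2 * c) * exp_ereal (- fenchel lam (real m)) * analytic_norm lam g"
    if g: "g \<in> analytic_space lam" and m: "m \<ge> m0" for g m
  proof -
    note cont = analytic_space_continuous[OF g]
    have "cmod ((g - fourier_sum m g) x) \<le> 2 * c * E (real m) * N g" for x
    proof -
      have "0 \<le> c * E (real m) * N g"
        using c E_nonneg N_nonneg by simp
      then have "cmod (g x - fourier_sum m g x) \<le> 2 * c * E (real m) * N g"
        using err[OF g m, of x] by linarith
      then show ?thesis by simp
    qed
    then show ?thesis
      unfolding trig_proj_eq_fourier_sum[OF cont] exp_ereal_eq_E analytic_norm_eq_N[OF g]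
      by (intro Linf_norm_le) (auto simp: fun_diff_def intro!: continuous_intros cont continuous_on_fourier_sum)
  qed
  moreover have "Linf_norm g
      \<le> ereal c * exp_ereal (- fenchel lam (of_int \<lfloor>pi / \<delta> - 1 / 2\<rfloor>)) * analytic_norm lam g
        + ereal (1 / \<delta> * L1_norm g)"
    \<comment> \<open>The threshold for \<open>\<delta>\<close> is chosen so that
      \<open>pi / \<delta> \<ge> m0 + 1\<close>; subtracting \<open>1 / 2\<close> and rounding down
      still leaves at least \<open>m0\<close>.\<close>
    if g: "g \<in> analytic_space lam" and \<delta>: "0 < \<delta>" "\<delta> \<le> pi / (real m0 + 1)" for g \<delta>
  proof -
    note cont = analytic_space_continuous[OF g]
    \<comment> \<open>The floor is at least \<open>m0\<close>, as shown next, so \<open>nat\<close>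
      does not truncate it.\<close>
    define m where "m = nat \<lfloor>pi / \<delta> - 1 / 2\<rfloor>"
    have "real m0 + 1 \<le> pi / \<delta>"
      using \<delta> by (simp add: field_simps)
    then have fl: "int m0 \<le> \<lfloor>pi / \<delta> - 1 / 2\<rfloor>"
      by (simp add: le_floor_iff)
    then have m: "m \<ge> m0" "of_int \<lfloor>pi / \<delta> - 1 / 2\<rfloor> = real m"
      by (auto simp: m_def)
    then have "real m \<le> pi / \<delta> - 1 / 2"
      by (metis of_int_floor_le)
    then have "(2 * real m + 1) / (2 * pi) \<le> 1 / \<delta>"
      using \<delta>(1) by (simp add: field_simps)
    moreover have "0 \<le> L1_norm g"
      unfolding L1_norm_def by simp
    ultimately have "(2 * real m + 1) / (2 * pi) * L1_norm g \<le> 1 / \<delta> * L1_norm g"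
      by (rule mult_right_mono)
    then have "cmod (g x) \<le> c * E (real m) * N g + 1 / \<delta> * L1_norm g" for x
      using err[OF g m(1), of x] norm_fourier_sum_le[OF cont, of m x]
        norm_triangle_sub[of "g x" "fourier_sum m g x"] by linarith
    then show ?thesis
      unfolding m(2) exp_ereal_eq_E analytic_norm_eq_N[OF g]
      by (intro Linf_norm_le cont) simp
  qed
  moreover have "pi / (real m0 + 1) > 0"
    by simp
  moreover have "complex_banach_on fun_scale (analytic_space lam) (\<lambda>g. real_of_ereal (analytic_norm lam g))"
    using complex_banach_on_analytic_space unfolding N_def[abs_def] .
  moreover have "ereal (cmod (fourier_coeff g n))
      \<le> exp_ereal (- fenchel lam \<bar>real_of_int n\<bar>) * analytic_norm lam g"
    if g: "g \<in> analytic_space lam" for g n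
    using norm_fourier_coeff_le_E[OF g, of n] by (simp add: exp_ereal_eq_E analytic_norm_eq_N[OF g])
  ultimately show ?thesis
    using c by blast
qed

end
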